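(* Let $q\in(0,1)$ and let $a,b\in\mathbb{R}$ be such that $0<|a|<1$ and $|b|<1$. Then for all $m,n\in\mathbb{N}_{0}$, the Al-Salam--Chihara polynomials $Q_n(\,\cdot\,;a,b\,|\,q)$ satisfy \[ \frac{(q;q)_{\infty}}{2\pi(qb/a;q)_{\infty}}\int_{0}^{\pi}Q_{m}(\cos\theta;a,b\,|\,q)\,Q_{n}(\cos\theta;a,b\,|\,q)\left|\frac{(e^{2\mathrm{i}\theta},qe^{\mathrm{i}\theta}/a;q)_{\infty}}{(be^{\mathrm{i}\theta};q)_{\infty}}\right|^{2}\mathrm{d}\theta =(-a)^{m+n}q^{\frac{m(m-1)+n(n-1)}{2}}\;{}_{0}\phi_{1}\!\left(-;\,qb/a;\,q,\,\frac{q^{2-m-n}}{a^{2}}\right). \]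
   Context: For $q\in(0,1)$: $(c;q)_{n}:=\prod_{j=0}^{n-1}(1-cq^{j})$ for $n\in\mathbb{N}_0\cup\{\infty\}$ and $(c_{1},\dots,c_{p};q)_{n}:=(c_{1};q)_{n}\cdots(c_{p};q)_{n}$. The basic hypergeometric series used is \[ {}_{0}\phi_{1}(-;c;q,z)=\sum_{k=0}^{\infty}\frac{q^{k(k-1)}z^{k}}{(c;q)_{k}(q;q)_{k}}. \] The Al-Salam--Chihara polynomials are defined by $Q_{-1}(x;a,b\,|\,q)=0$, $Q_{0}(x;a,b\,|\,q)=1$ and, for $n\in\mathbb{N}_0$, \[ Q_{n+1}(x;a,b\,|\,q)=\left(2x-(a+b)q^{n}\right)Q_{n}(x;a,b\,|\,q)-(1-q^{n})(1-abq^{n-1})Q_{n-1}(x;a,b\,|\,q). \] $\mathbb{N}_0=\{0,1,2,\dots\}$.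
   Formalization: The formal statement additionally assumes (qb/a)q^j ≠ 1 for all j in N_0; otherwise (e.g. q=1/2, a=1/4, b=1/2) the factor 1/(qb/a;q)_∞ and the series 0φ1 with parameter qb/a divide by zero and the formula is undefined. *)

theory Defs
  imports "HOL-Analysis.Analysis"
begin

definition qpochhammer :: "'a::comm_ring_1 \<Rightarrow> 'a \<Rightarrow> nat \<Rightarrow> 'a" where
  "qpochhammer c q n = (\<Prod>j<n. 1 - c * q ^ j)"

definition qpochhammer_inf :: "'a::real_normed_field \<Rightarrow> 'a \<Rightarrow> 'a" where
  "qpochhammer_inf c q = (\<Prod>j. 1 - c * q ^ j)"

definition phi01 :: "'a::real_normed_field \<Rightarrow> 'a \<Rightarrow> 'a \<Rightarrow> 'a" where
  "phi01 c q z = (\<Sum>k. q ^ (k * (k - 1)) * z ^ k / (qpochhammer c q k * qpochhammer q q k))"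

(* Index -1 is avoided: in the recurrence for Q_1 the coefficient of Q_{-1} = 0 vanishes,
   so Q_1 is given directly and the recurrence is shifted by one. *)
fun al_salam_chihara :: "nat \<Rightarrow> real \<Rightarrow> real \<Rightarrow> real \<Rightarrow> real \<Rightarrow> real" where
  "al_salam_chihara 0 x a b q = 1"
| "al_salam_chihara (Suc 0) x a b q = 2 * x - (a + b)"
| "al_salam_chihara (Suc (Suc n)) x a b q =
     (2 * x - (a + b) * q ^ Suc n) * al_salam_chihara (Suc n) x a b q
     - (1 - q ^ Suc n) * (1 - a * b * q ^ n) * al_salam_chihara n x a b q"

end

theory Submission
  imports Defs
begin

text \<open>
  Write \<open>x = cos \<theta>\<close>, \<open>z = exp (\<i> \<theta>)\<close>, \<open>R(c) = |(cz;q)\<^sub>\<infinity>|\<^sup>2\<close>, \<open>V = |(z\<^sup>2;q)\<^sub>\<infinity>|\<^sup>2\<close>, and let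
  \<open>L(c,b)\<close> be the functional \<open>f \<mapsto> (q;q)\<^sub>\<infinity> / (2\<pi>) \<integral> f(x) V R(c) / R(b) d\<theta>\<close>; the theorem concerns \<open>c = q/a\<close>.
  Since \<open>R(c) = (1 - 2cx + c\<^sup>2) R(cq)\<close>, a \<open>q\<close>-shift of \<open>b\<close> or \<open>c\<close> multiplies the weight by a linear
  polynomial, and the Christoffel formula for the polynomials turns this into contiguous relations
  for their moments. The moments are determined by these relations together with their behaviour in a limit:
  \<^item> \<open>L(0,0)\<close> annihilates the \<open>q\<close>-Hermite polynomials of positive degree. For the weight truncated to
    \<open>N\<close> factors the moments satisfy a recurrence in \<open>N\<close> with a closed-form solution.
  \<^item> Shifting \<open>b \<rightarrow> bq \<rightarrow> \<dots> \<rightarrow> 0\<close> carries this over to \<open>L(0,b)\<close> and \<open>Q\<^sub>n(\<cdot>;0,b)\<close>; the growth of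
    \<open>Q\<^sub>n\<close> in \<open>n\<close> is subexponential, which excludes the other solution \<open>b\<^sup>-\<^sup>n\<close> of the relation.
  \<^item> Shifting \<open>a \<rightarrow> a/q \<rightarrow> \<dots> \<rightarrow> \<infinity>\<close> reduces \<open>L(q/a,b)\<close> to \<open>L(0,b)\<close>. The claimed series satisfies the
    same relation and has the same limit, which settles the case \<open>n = 0\<close>.
  \<^item> Multiplication by \<open>2x\<close> is symmetric for \<open>L(q/a,b)\<close>, so the case \<open>n = 0\<close> and the three-term
    recurrence give all \<open>m, n\<close> by induction.
\<close>

section \<open>The \<open>q\<close>-Pochhammer symbol\<close>

lemma qpochhammer_0 [simp]: "qpochhammer c q 0 = 1"
  by (simp add: qpochhammer_def)

lemma qpochhammer_Suc: "qpochhammer c q (Suc n) = qpochhammer c q n * (1 - c * q ^ n)"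
  by (simp add: qpochhammer_def)

lemma qpochhammer_add:
  "qpochhammer c q (m + n) = qpochhammer c q m * qpochhammer (c * q ^ m) q n"
  by (induction n) (simp_all add: qpochhammer_Suc power_add algebra_simps)

lemma qpochhammer_pos:
  fixes q :: real
  assumes "0 < q" "q < 1" "c < 1"
  shows "0 < qpochhammer c q n"
  unfolding qpochhammer_def
proof (rule prod_pos)
  fix j
  have "c * q ^ j < 1"
  proof (cases "c \<le> 0")
    case True
    then have "c * q ^ j \<le> 0" using assms by (simp add: mult_nonpos_nonneg)
    then show ?thesis by simp
  next
    case False
    then have "c * q ^ j \<le> c" using assms by (simp add: mult_left_le power_le_one)
    then show ?thesis using assms by simp
  qed
  then show "0 < 1 - c * q ^ j" by simp
qed

context
  fixes q :: "'a::{real_normed_field,banach}"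
  assumes q: "norm q < 1"
begin

lemma convergent_prod_qpochhammer: "convergent_prod (\<lambda>j. 1 - c * q ^ j)"
proof (rule abs_convergent_prod_imp_convergent_prod)
  have "summable (\<lambda>j. norm c * norm q ^ j)"
    using q by (intro summable_mult summable_geometric) auto
  then show "abs_convergent_prod (\<lambda>j. 1 - c * q ^ j)"
    unfolding abs_convergent_prod_conv_summable by (simp add: norm_mult norm_power)
qed

lemma qpochhammer_LIMSEQ: "qpochhammer c q \<longlonglongrightarrow> qpochhammer_inf c q"
  unfolding qpochhammer_def qpochhammer_inf_def
  using convergent_prod_has_prod[OF convergent_prod_qpochhammer] by (rule has_prod_imp_tendsto')

lemma qpochhammer_inf_split:
  "qpochhammer_inf c q = qpochhammer c q n * qpochhammer_inf (c * q ^ n) q"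
proof (rule LIMSEQ_unique)
  show "(\<lambda>k. qpochhammer c q (n + k)) \<longlonglongrightarrow> qpochhammer_inf c q"
    using LIMSEQ_ignore_initial_segment[OF qpochhammer_LIMSEQ, of c n] by (simp add: add.commute)
  show "(\<lambda>k. qpochhammer c q (n + k)) \<longlonglongrightarrow> qpochhammer c q n * qpochhammer_inf (c * q ^ n) q"
    unfolding qpochhammer_add by (intro tendsto_intros qpochhammer_LIMSEQ)
qed

lemma qpochhammer_inf_rec: "qpochhammer_inf c q = (1 - c) * qpochhammer_inf (c * q) q"
  using qpochhammer_inf_split[of c 1] by (simp add: qpochhammer_def)

text \<open>A convergent infinite product vanishes only through one of its factors.\<close>

lemma qpochhammer_inf_eq_0_iff: "qpochhammer_inf c q = 0 \<longleftrightarrow> (\<exists>j. c * q ^ j = 1)"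
  using has_prod_eq_0_iff[OF convergent_prod_has_prod[OF convergent_prod_qpochhammer[of c]]]
  unfolding qpochhammer_inf_def by (auto simp: eq_commute[of 1])

text \<open>Expanding the product bounds its distance from 1 by the exponential of a geometric sum.
  The bound is independent of \<open>n\<close> and vanishes as \<open>c\<close> tends to 0, so it
  serves both as a majorant and as a rate of convergence.\<close>

lemma norm_qpochhammer_minus_1: "norm (qpochhammer c q n - 1) \<le> exp (norm c / (1 - norm q)) - 1"
proof -
  have "norm (qpochhammer c q n - 1) \<le> (\<Prod>j<n. 1 + norm (- (c * q ^ j))) - 1"
    using norm_prod_minus1_le_prod_minus1[of "\<lambda>j. - (c * q ^ j)" "{..<n}"]
    by (simp add: qpochhammer_def)
  also have "(\<Prod>j<n. 1 + norm (- (c * q ^ j))) \<le> exp (\<Sum>j<n. norm (- (c * q ^ j)))"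
    by (intro prod_le_exp_sum) auto
  also have "(\<Sum>j<n. norm (- (c * q ^ j))) = norm c * (\<Sum>j<n. norm q ^ j)"
    by (simp add: norm_mult norm_power sum_distrib_left)
  also have "(\<Sum>j<n. norm q ^ j) \<le> (\<Sum>j. norm q ^ j)"
    using q by (intro sum_le_suminf summable_geometric) auto
  also have "(\<Sum>j. norm q ^ j) = 1 / (1 - norm q)"
    using q by (intro suminf_geometric) auto
  finally show ?thesis by (simp add: mult_left_mono)
qed

lemma norm_qpochhammer_inf_minus_1: "norm (qpochhammer_inf c q - 1) \<le> exp (norm c / (1 - norm q)) - 1"
  by (rule LIMSEQ_le_const2[OF tendsto_norm[OF tendsto_diff[OF qpochhammer_LIMSEQ tendsto_const]]])
     (use norm_qpochhammer_minus_1 in blast)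

lemma norm_qpochhammer_le: "norm (qpochhammer c q n) \<le> exp (norm c / (1 - norm q))"
  using norm_qpochhammer_minus_1[of c n] norm_triangle_sub[of "qpochhammer c q n" 1] by simp

lemma norm_qpochhammer_inf_le: "norm (qpochhammer_inf c q) \<le> exp (norm c / (1 - norm q))"
  using norm_qpochhammer_inf_minus_1[of c] norm_triangle_sub[of "qpochhammer_inf c q" 1] by simp

text \<open>Once the first \<open>n\<close> factors are split off, the remaining product has
  parameter \<open>c * q ^ n\<close>, which tends to 0 uniformly on the disc.\<close>

lemma uniform_limit_qpochhammer:
  "uniform_limit (cball 0 r) (\<lambda>n c. qpochhammer c q n) (\<lambda>c. qpochhammer_inf c q) sequentially"
proof (rule uniform_limitI)
  fix e :: real assume "e > 0"
  define K where "K = exp (r / (1 - norm q))"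
  have "(\<lambda>n. K * (exp (r * norm q ^ n / (1 - norm q)) - 1)) \<longlonglongrightarrow> K * (exp (r * 0 / (1 - norm q)) - 1)"
    using q by (intro tendsto_intros LIMSEQ_realpow_zero) auto
  then have "\<forall>\<^sub>F n in sequentially. K * (exp (r * norm q ^ n / (1 - norm q)) - 1) < e"
    using \<open>e > 0\<close> by (intro order_tendstoD) auto
  then show "\<forall>\<^sub>F n in sequentially. \<forall>c\<in>cball 0 r. dist (qpochhammer c q n) (qpochhammer_inf c q) < e"
  proof (rule eventually_mono, intro ballI)
    fix n and c :: 'a assume n: "K * (exp (r * norm q ^ n / (1 - norm q)) - 1) < e" and "c \<in> cball 0 r"
    then have c: "norm c \<le> r" by simp
    have "dist (qpochhammer c q n) (qpochhammer_inf c q)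
        = norm (qpochhammer c q n * (qpochhammer_inf (c * q ^ n) q - 1))"
      by (subst qpochhammer_inf_split[of c n]) (simp add: dist_norm norm_minus_commute algebra_simps)
    also have "\<dots> \<le> K * (exp (r * norm q ^ n / (1 - norm q)) - 1)"
      unfolding norm_mult
    proof (intro mult_mono)
      show "norm (qpochhammer c q n) \<le> K"
        using c q by (intro order.trans[OF norm_qpochhammer_le]) (simp add: K_def divide_right_mono)
      show "norm (qpochhammer_inf (c * q ^ n) q - 1) \<le> exp (r * norm q ^ n / (1 - norm q)) - 1"
        using c q by (intro order.trans[OF norm_qpochhammer_inf_minus_1])
          (simp add: norm_mult norm_power divide_right_mono mult_right_mono)
    qed (auto simp: K_def)
    finally show "dist (qpochhammer c q n) (qpochhammer_inf c q) < e" using n by simp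
  qed
qed

lemma continuous_on_qpochhammer_inf: "continuous_on A (\<lambda>c. qpochhammer_inf c q)"
proof -
  have "continuous_on (cball (0::'a) r) (\<lambda>c. qpochhammer_inf c q)" for r
    by (rule uniform_limit_theorem[OF _ uniform_limit_qpochhammer])
       (auto simp: qpochhammer_def intro!: always_eventually continuous_intros)
  then have "continuous_on (ball (0::'a) r) (\<lambda>c. qpochhammer_inf c q)" for r
    using continuous_on_subset ball_subset_cball by blast
  then have "isCont (\<lambda>c. qpochhammer_inf c q) x" for x
    using continuous_on_eq_continuous_at[of "ball 0 (norm x + 1)"] by force
  then show ?thesis by (simp add: continuous_at_imp_continuous_on)
qed

end


section \<open>Al-Salam--Chihara and \<open>q\<close>-Hermite polynomials\<close>

lemma al_salam_chihara_commute: "al_salam_chihara n x a b q = al_salam_chihara n x b a q"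
  by (induction n x a b q rule: al_salam_chihara.induct) (simp_all add: algebra_simps)

text \<open>Changes the parameter without touching a weight; iterating it moves \<open>a\<close>
  towards 0 when the functional is fixed.\<close>

lemma al_salam_chihara_shift_param:
  "al_salam_chihara (Suc n) x a b q =
     al_salam_chihara (Suc n) x (a * q) b q - a * (1 - q ^ Suc n) * al_salam_chihara n x (a * q) b q"
proof (induction n rule: induct_nat_012)
  case (ge2 n)
  show ?case
    unfolding al_salam_chihara.simps(3)[of "Suc n" x a b q] ge2
    by (simp add: algebra_simps)
qed (simp_all add: algebra_simps power2_eq_square)

text \<open>The orthogonality weight of these polynomials contains 1/R(a), so replacing
  \<open>a\<close> by \<open>a * q\<close> multiplies it by the linear factor on the left. The
  identity itself follows from the recurrence alone, for all parameters.\<close>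

lemma al_salam_chihara_christoffel:
  "(1 + a\<^sup>2 - 2 * a * x) * al_salam_chihara n x (a * q) b q =
     (1 - a * b * q ^ n) * al_salam_chihara n x a b q - a * al_salam_chihara (Suc n) x a b q"
proof (induction n rule: induct_nat_012)
  case (ge2 n)
  have "(1 + a\<^sup>2 - 2 * a * x) * al_salam_chihara (Suc (Suc n)) x (a * q) b q =
     (2 * x - (a * q + b) * q ^ Suc n) * ((1 + a\<^sup>2 - 2 * a * x) * al_salam_chihara (Suc n) x (a * q) b q)
     - (1 - q ^ Suc n) * (1 - a * q * b * q ^ n) * ((1 + a\<^sup>2 - 2 * a * x) * al_salam_chihara n x (a * q) b q)"
    by (simp add: algebra_simps)
  then show ?case
    unfolding ge2 by (simp add: algebra_simps)
qed (simp_all add: algebra_simps power2_eq_square)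

lemma continuous_on_al_salam_chihara [continuous_intros]:
  assumes "continuous_on A f" "continuous_on A g" "continuous_on A h"
  shows "continuous_on A (\<lambda>t. al_salam_chihara n (f t) (g t) (h t) q)"
  by (induction n rule: induct_nat_012) (auto intro!: continuous_intros assms)

abbreviation q_hermite :: "nat \<Rightarrow> real \<Rightarrow> real \<Rightarrow> real" where
  "q_hermite n x q \<equiv> al_salam_chihara n x 0 0 q"

text \<open>The three-term recurrence applied twice. Truncated subtraction is harmless: for
  \<open>n\<close> at most 1 the coefficient of the last term is 0.\<close>

lemma q_hermite_mult_4_sq:
  "4 * x\<^sup>2 * q_hermite n x q =
     q_hermite (n + 2) x q + (2 - q ^ (n + 1) - q ^ n) * q_hermite n x q
     + (1 - q ^ n) * (1 - q ^ (n - 1)) * q_hermite (n - 2) x q"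
proof -
  consider "n = 0" | "n = 1" | m where "n = Suc (Suc m)"
    by (metis One_nat_def not0_implies_Suc)
  then show ?thesis
    by cases (simp_all add: algebra_simps power2_eq_square)
qed

text \<open>\<^term>\<open>u\<close> and \<^term>\<open>v\<close> are the coefficients of the \<open>q\<close>-exponentials \<open>1/(zt;q)\<^sub>\<infinity>\<close> and
  \<open>1/(wt;q)\<^sub>\<infinity>\<close>; with \<open>w = 1/z\<close> their product is the \<open>q\<close>-Hermite generating function.\<close>

lemma q_exp_conv_rec:
  fixes z w q :: "'a::field" and u v :: "nat \<Rightarrow> 'a"
  assumes u: "\<And>k. (1 - q ^ Suc k) * u (Suc k) = z * u k"
    and v: "\<And>k. (1 - q ^ Suc k) * v (Suc k) = w * v k"
  defines "f \<equiv> \<lambda>n. \<Sum>k\<le>n. u k * v (n - k)"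
  shows "(1 - q ^ Suc (Suc n)) * f (Suc (Suc n)) = (z + w) * f (Suc n) - z * w * f n"
proof -
  \<comment> \<open>\<open>g\<close> collects the coefficients of the product in which the first
    q-exponential is dilated from t to qt.\<close>
  define g where "g = (\<lambda>n. \<Sum>k\<le>n. q ^ k * u k * v (n - k))"
  have g: "g (Suc n) = f (Suc n) - z * f n" for n
  proof -
    have "f (Suc n) - g (Suc n) = (\<Sum>k\<le>Suc n. (1 - q ^ k) * u k * v (Suc n - k))"
      unfolding f_def g_def sum_subtractf[symmetric] by (intro sum.cong) (auto simp: algebra_simps)
    also have "\<dots> = (\<Sum>k\<le>n. z * u k * v (n - k))"
      unfolding sum.atMost_Suc_shift u by simp
    finally show ?thesis
      by (simp add: f_def sum_distrib_left mult.assoc algebra_simps)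
  qed
  \<comment> \<open>The splitting 1 - q^(n+1) = (1 - q^k) + q^k (1 - q^(n+1-k)) lets each hypothesis
    lower one of the two indices.\<close>
  have f: "(1 - q ^ Suc n) * f (Suc n) = z * f n + w * g n" for n
  proof -
    have "(1 - q ^ Suc n) * f (Suc n) =
        (\<Sum>k\<le>Suc n. (1 - q ^ k) * u k * v (Suc n - k)) +
        (\<Sum>k\<le>Suc n. q ^ k * u k * ((1 - q ^ (Suc n - k)) * v (Suc n - k)))"
      unfolding f_def sum_distrib_left sum.distrib[symmetric]
    proof (intro sum.cong refl)
      fix k assume "k \<in> {..Suc n}"
      then have "q ^ Suc n = q ^ k * q ^ (Suc n - k)"
        by (metis atMost_iff le_add_diff_inverse power_add)
      then show "(1 - q ^ Suc n) * (u k * v (Suc n - k)) = (1 - q ^ k) * u k * v (Suc n - k) +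
          q ^ k * u k * ((1 - q ^ (Suc n - k)) * v (Suc n - k))"
        by (simp only:) (simp add: algebra_simps)
    qed
    also have "(\<Sum>k\<le>Suc n. (1 - q ^ k) * u k * v (Suc n - k)) = z * f n"
      unfolding sum.atMost_Suc_shift u by (simp add: f_def sum_distrib_left mult.assoc)
    also have "(\<Sum>k\<le>Suc n. q ^ k * u k * ((1 - q ^ (Suc n - k)) * v (Suc n - k))) =
        (\<Sum>k\<le>n. q ^ k * u k * ((1 - q ^ Suc (n - k)) * v (Suc (n - k))))"
      by (auto intro!: sum.cong simp: Suc_diff_le)
    also have "\<dots> = w * g n"
      unfolding v by (auto simp: g_def sum_distrib_left intro!: sum.cong)
    finally show ?thesis .
  qed
  show ?thesis
    unfolding f[of "Suc n"] g by (simp add: algebra_simps)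
qed

section \<open>Fourier expansion of the q-Hermite polynomials\<close>

lemma has_integral_cos_int_mult:
  "((\<lambda>t. cos (of_int m * t)) has_integral (if m = 0 then pi else 0)) {0..pi}"
proof (cases "m = 0")
  case True
  then show ?thesis using has_integral_const_real[of "1::real" 0 pi] by simp
next
  case False
  have "((\<lambda>t. cos (of_int m * t)) has_integral
      (sin (of_int m * pi) / of_int m - sin (of_int m * 0) / of_int m)) {0..pi}"
    by (rule fundamental_theorem_of_calculus)
       (use False in \<open>auto simp: has_real_derivative_iff_has_vector_derivative[symmetric]
          intro!: derivative_eq_intros\<close>)
  moreover have "sin (of_int m * pi) = 0"
    by (metis mult.commute sin_zero_iff_int2)
  ultimately show ?thesis using False by simp
qed

locale q_unit =
  fixes q :: real
  assumes q_pos: "0 < q" and q_less_1: "q < 1"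
begin

abbreviation qfact :: "nat \<Rightarrow> real" where "qfact n \<equiv> qpochhammer q q n"

lemma qfact_Suc: "qfact (Suc n) = qfact n * (1 - q ^ Suc n)"
  by (simp add: qpochhammer_Suc)

lemma qfact_pos: "0 < qfact n"
  using qpochhammer_pos[OF q_pos q_less_1 q_less_1] .

lemma q_power_less_1: "q ^ Suc n < 1"
  using q_pos q_less_1 power_Suc_less_one by blast

text \<open>Rogers' formula with the q-binomial coefficients written out. The right-hand side obeys
  the q-Hermite recurrence by \<open>q_exp_conv_rec\<close>, applied to e^(it) and e^(-it) and
  rescaled by (q;q)_n.\<close>

lemma q_hermite_cos_eq:
  "q_hermite n (cos t) q = qfact n * (\<Sum>k\<le>n. cos (of_int (2 * int k - int n) * t) / (qfact k * qfact (n - k)))"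
proof -
  define u where "u = (\<lambda>k. cis t ^ k / of_real (qfact k))"
  define v where "v = (\<lambda>k. cis (- t) ^ k / of_real (qfact k))"
  define f where "f = (\<lambda>n. \<Sum>k\<le>n. u k * v (n - k))"
  define Q where "Q = complex_of_real q"
  have nz: "qfact k \<noteq> 0" for k using qfact_pos[of k] by simp
  have nz': "1 - Q ^ Suc k \<noteq> 0" for k
  proof -
    have "1 - Q ^ Suc k = of_real (1 - q ^ Suc k)" by (simp add: Q_def)
    moreover have "1 - q ^ Suc k \<noteq> 0" using q_power_less_1[of k] by linarith
    ultimately show ?thesis by (simp only: of_real_eq_0_iff not_False_eq_True)
  qed
  have of_real_qfact: "complex_of_real (qfact (Suc k)) = of_real (qfact k) * (1 - Q ^ Suc k)" for k
    by (simp add: qfact_Suc Q_def)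
  have u: "(1 - Q ^ Suc k) * u (Suc k) = cis t * u k" for k
    unfolding u_def of_real_qfact using nz[of k] nz'[of k] by (simp add: field_simps)
  have v: "(1 - Q ^ Suc k) * v (Suc k) = cis (- t) * v k" for k
    unfolding v_def of_real_qfact using nz[of k] nz'[of k] by (simp add: field_simps)
  have cis2: "cis t + cis (- t) = of_real (2 * cos t)" "cis t * cis (- t) = 1"
    by (auto simp: complex_eq_iff cis_mult)
  have "of_real (q_hermite n (cos t) q) = of_real (qfact n) * f n"
  proof (induction n rule: induct_nat_012)
    case 0
    then show ?case by (simp add: f_def u_def v_def)
  next
    case 1
    have "(1 - Q) * f 1 = cis t + cis (- t)"
      using u[of 0] v[of 0] by (simp add: f_def atMost_Suc algebra_simps u_def v_def)
    then show ?case by (simp add: cis2 qpochhammer_def Q_def)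
  next
    case (ge2 n)
    have "of_real (qfact (Suc (Suc n))) * f (Suc (Suc n)) =
        of_real (qfact (Suc n)) * ((1 - Q ^ Suc (Suc n)) * f (Suc (Suc n)))"
      by (simp add: of_real_qfact)
    also have "(1 - Q ^ Suc (Suc n)) * f (Suc (Suc n)) =
        (cis t + cis (- t)) * f (Suc n) - cis t * cis (- t) * f n"
      unfolding f_def by (rule q_exp_conv_rec) (use u v in auto)
    also have "of_real (qfact (Suc n)) * \<dots> =
        of_real (2 * cos t) * (of_real (qfact (Suc n)) * f (Suc n)) -
        (1 - Q ^ Suc n) * (of_real (qfact n) * f n)"
      unfolding cis2 by (simp add: of_real_qfact algebra_simps)
    finally show ?case
      unfolding ge2[symmetric] by (simp add: Q_def)
  qed
  \<comment> \<open>Taking real parts turns exponentials into cosines without pairing the terms k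
    and n - k.\<close>
  then have "q_hermite n (cos t) q = Re (of_real (qfact n) * f n)"
    by (metis Re_complex_of_real)
  also have "\<dots> = qfact n * (\<Sum>k\<le>n. Re (u k * v (n - k)))"
    by (simp add: f_def)
  also have "(\<Sum>k\<le>n. Re (u k * v (n - k))) =
      (\<Sum>k\<le>n. cos (of_int (2 * int k - int n) * t) / (qfact k * qfact (n - k)))"
  proof (intro sum.cong refl)
    fix k assume "k \<in> {..n}"
    then have "cis t ^ k * cis (- t) ^ (n - k) = cis (of_int (2 * int k - int n) * t)"
      unfolding Complex.DeMoivre cis_mult
      by (intro arg_cong[where f = cis]) (simp add: of_nat_diff algebra_simps)
    then have "u k * v (n - k) = cis (of_int (2 * int k - int n) * t) / of_real (qfact k * qfact (n - k))"
      by (simp add: u_def v_def)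
    then show "Re (u k * v (n - k)) = cos (of_int (2 * int k - int n) * t) / (qfact k * qfact (n - k))"
      by (simp only: Re_divide_of_real) simp
  qed
  finally show ?thesis .
qed

text \<open>Only the constant Fourier mode k = n/2 survives. This is the start N = 0 of the
  recurrence for truncated weights.\<close>

lemma has_integral_q_hermite:
  "((\<lambda>t. q_hermite n (cos t) q) has_integral
     (if even n then pi * qfact n / (qfact (n div 2))\<^sup>2 else 0)) {0..pi}"
proof -
  have "((\<lambda>t. qfact n * (\<Sum>k\<le>n. cos (of_int (2 * int k - int n) * t) * (1 / (qfact k * qfact (n - k)))))
     has_integral (qfact n * (\<Sum>k\<le>n. (if 2 * int k - int n = 0 then pi else 0) * (1 / (qfact k * qfact (n - k))))))
     {0..pi}"
    by (intro has_integral_mult_right has_integral_sum has_integral_mult_left has_integral_cos_int_mult) auto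
  also have "(\<Sum>k\<le>n. (if 2 * int k - int n = 0 then pi else 0) * (1 / (qfact k * qfact (n - k)))) =
      (\<Sum>k\<in>{k\<in>{..n}. 2 * k = n}. pi / (qfact k * qfact (n - k)))"
    by (intro sum.mono_neutral_cong_right) (auto split: if_splits)
  also have "{k\<in>{..n}. 2 * k = n} = (if even n then {n div 2} else {})"
    by auto
  finally have *: "((\<lambda>t. q_hermite n (cos t) q) has_integral
      (qfact n * (\<Sum>k\<in>(if even n then {n div 2} else {}). pi / (qfact k * qfact (n - k))))) {0..pi}"
    by (simp add: q_hermite_cos_eq)
  have "n - n div 2 = n div 2" if "even n" using that by auto
  then have "qfact n * (\<Sum>k\<in>(if even n then {n div 2} else {}). pi / (qfact k * qfact (n - k))) =
      (if even n then pi * qfact n / (qfact (n div 2))\<^sup>2 else 0)"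
    by (simp add: power2_eq_square)
  with * show ?thesis by simp
qed

section \<open>q-Hermite moments of the truncated weight\<close>

lemma cmod_1_minus_cis:
  "(cmod (1 - of_real c * cis t))\<^sup>2 = 1 + c\<^sup>2 - 2 * c * cos t"
proof -
  have "(cmod (1 - of_real c * cis t))\<^sup>2 = (1 - c * cos t)\<^sup>2 + (c * sin t)\<^sup>2"
    by (simp add: cmod_power2)
  then show ?thesis
    by (simp add: power_mult_distrib sin_squared_eq power2_diff algebra_simps)
qed

definition vweight :: "real \<Rightarrow> real" where
  "vweight t = (cmod (qpochhammer_inf (cis (2 * t)) (of_real q)))\<^sup>2"

definition vweight_fin :: "nat \<Rightarrow> real \<Rightarrow> real" where
  "vweight_fin N t = (cmod (qpochhammer (cis (2 * t)) (of_real q) N))\<^sup>2"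

lemma vweight_fin_0 [simp]: "vweight_fin 0 t = 1"
  by (simp add: vweight_fin_def)

text \<open>Each new factor is linear in 4x^2, so that \<open>q_hermite_mult_4_sq\<close> produces a
  recurrence in \<open>N\<close>.\<close>

lemma vweight_fin_Suc:
  "vweight_fin (Suc N) t = ((1 + q ^ N)\<^sup>2 - q ^ N * (4 * (cos t)\<^sup>2)) * vweight_fin N t"
proof -
  have "(cmod (1 - cis (2 * t) * of_real q ^ N))\<^sup>2 = (1 + q ^ N)\<^sup>2 - q ^ N * (4 * (cos t)\<^sup>2)"
    using cmod_1_minus_cis[of "q ^ N" "2 * t"] unfolding cos_double_cos
    by (simp add: mult.commute[of "cis (2 * t)"] power2_sum right_diff_distrib)
  then show ?thesis
    by (simp add: vweight_fin_def qpochhammer_Suc norm_mult power_mult_distrib)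
qed

lemma continuous_on_vweight_fin: "continuous_on A (vweight_fin N)"
  by (induction N) (auto simp: vweight_fin_Suc[abs_def] vweight_fin_0[abs_def] intro!: continuous_intros)

text \<open>The closed form comes from the connection coefficients between the \<open>q\<close>-Hermite polynomials and the
  Rogers polynomials with \<open>\<beta> = q\<^sup>N\<close>, which are orthogonal for the truncated weight.\<close>

definition hermite_moment :: "nat \<Rightarrow> nat \<Rightarrow> real" where
  "hermite_moment N j = 2 * pi * qfact (2 * N) * qfact (2 * j) * q ^ (N * j) /
     ((1 + q ^ N) * qfact N * qfact j * qfact (N + j))"

text \<open>The recurrence of \<open>hermite_integral_Suc\<close> at n = 0, where the term of degree
  n - 2 is absent. After extracting \<open>C\<close> it is a rational identity in q and q^N.\<close>

lemma hermite_moment_Suc_0: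
  "hermite_moment (Suc N) 0 =
     ((1 + q ^ N)\<^sup>2 - q ^ N * (1 - q)) * hermite_moment N 0 - q ^ N * hermite_moment N 1"
proof -
  define B where "B = q ^ N"
  define C where "C = 2 * pi * qfact (2 * N) / (qfact N * qfact N)"
  have B: "0 < B" "B \<le> 1" using q_pos q_less_1 by (auto simp: B_def power_le_one)
  have qB: "1 - q * B \<noteq> 0" using q_power_less_1[of N] by (simp add: B_def)
  have "0 < q * B" using B q_pos by simp
  then have pos: "1 + B \<noteq> 0" "1 + q * B \<noteq> 0" "1 - q \<noteq> 0" using B q_less_1 by linarith+
  have "hermite_moment N 0 = C / (1 + B)"
    by (simp add: hermite_moment_def C_def B_def)
  moreover have "hermite_moment N 1 = C * B * (1 - q\<^sup>2) / ((1 + B) * (1 - q * B))"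
    using pos by (simp add: hermite_moment_def C_def B_def qfact_Suc numeral_2_eq_2 power2_eq_square mult_ac)
  moreover have "hermite_moment (Suc N) 0 =
      C * (1 - q * B\<^sup>2) * (1 - q\<^sup>2 * B\<^sup>2) / ((1 + q * B) * (1 - q * B)\<^sup>2)"
  proof -
    have "q ^ (2 * N) = B\<^sup>2" by (simp add: B_def power_mult mult.commute)
    then have "qfact (2 * Suc N) = qfact (2 * N) * (1 - q * B\<^sup>2) * (1 - q\<^sup>2 * B\<^sup>2)"
      by (simp add: qfact_Suc power2_eq_square mult.assoc)
    then show ?thesis
      by (simp add: hermite_moment_def C_def qfact_Suc power2_eq_square B_def[symmetric] mult.assoc)
        (simp add: mult_ac)
  qed
  moreover have "C * (1 - q * B\<^sup>2) * (1 - q\<^sup>2 * B\<^sup>2) / ((1 + q * B) * (1 - q * B)\<^sup>2) =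
      ((1 + B)\<^sup>2 - B * (1 - q)) * (C / (1 + B)) - B * (C * B * (1 - q\<^sup>2) / ((1 + B) * (1 - q * B)))"
    using qB pos by (simp add: divide_simps) algebra
  ultimately show ?thesis by (simp add: B_def)
qed

text \<open>The same recurrence at n = 2(i+1), where all three degrees occur.\<close>

lemma hermite_moment_Suc_Suc:
  "hermite_moment (Suc N) (Suc i) =
     ((1 + q ^ N)\<^sup>2 - q ^ N * (2 - q ^ (2 * Suc i + 1) - q ^ (2 * Suc i))) * hermite_moment N (Suc i)
     - q ^ N * hermite_moment N (Suc (Suc i))
     - q ^ N * ((1 - q ^ (2 * Suc i)) * (1 - q ^ (2 * Suc i - 1))) * hermite_moment N i"
proof -
  define B where "B = q ^ N"
  define T where "T = q ^ i"
  \<comment> \<open>\<open>C\<close> is common to all four moments; what remains is a rational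
    identity in \<open>q\<close>, \<open>B\<close> and \<open>T\<close>.\<close>
  define C where "C = 2 * pi * qfact (2 * N) * qfact (2 * i) * q ^ (N * i) / (qfact N * qfact i * qfact (N + i))"
  have B: "0 < B" "B \<le> 1" using q_pos q_less_1 by (auto simp: B_def power_le_one)
  have "0 < q * B" using B q_pos by simp
  then have pos: "1 + B \<noteq> 0" "1 + q * B \<noteq> 0" using B by linarith+
  have nz: "1 - q * B \<noteq> 0" "1 - q * T \<noteq> 0" "1 - q\<^sup>2 * T \<noteq> 0" "1 - q * B * T \<noteq> 0" "1 - q\<^sup>2 * B * T \<noteq> 0"
    using q_power_less_1[of N] q_power_less_1[of i] q_power_less_1[of "Suc i"] q_power_less_1[of "N + i"]
      q_power_less_1[of "Suc (N + i)"]
    by (auto simp: B_def T_def power_add power2_eq_square mult.assoc)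
  have pw: "q ^ (2 * N) = B\<^sup>2" "q ^ (2 * i) = T\<^sup>2"
    by (simp_all add: B_def T_def power_mult mult.commute)
  have qf1: "qfact (2 * Suc N) = qfact (2 * N) * (1 - q * B\<^sup>2) * (1 - q\<^sup>2 * B\<^sup>2)"
    using pw by (simp add: qfact_Suc power2_eq_square mult.assoc)
  have qf2: "qfact (2 * Suc i) = qfact (2 * i) * (1 - q * T\<^sup>2) * (1 - q\<^sup>2 * T\<^sup>2)"
    using pw by (simp add: qfact_Suc power2_eq_square mult.assoc)
  have qf3: "qfact (2 * Suc (Suc i)) =
      qfact (2 * i) * (1 - q * T\<^sup>2) * (1 - q\<^sup>2 * T\<^sup>2) * (1 - q ^ 3 * T\<^sup>2) * (1 - q ^ 4 * T\<^sup>2)"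
    using pw by (simp add: qfact_Suc power2_eq_square mult.assoc power3_eq_cube power4_eq_xxxx)
  have qf4: "qfact (Suc i) = qfact i * (1 - q * T)" "qfact (Suc (Suc i)) = qfact i * (1 - q * T) * (1 - q\<^sup>2 * T)"
     "qfact (Suc N) = qfact N * (1 - q * B)"
     "qfact (N + Suc i) = qfact (N + i) * (1 - q * B * T)"
     "qfact (N + Suc (Suc i)) = qfact (N + i) * (1 - q * B * T) * (1 - q\<^sup>2 * B * T)"
     "qfact (Suc N + Suc i) = qfact (N + i) * (1 - q * B * T) * (1 - q\<^sup>2 * B * T)"
    by (simp_all add: qfact_Suc T_def B_def power2_eq_square mult.assoc power_add)
  have pw2: "q ^ (N * Suc i) = q ^ (N * i) * B" "q ^ (N * Suc (Suc i)) = q ^ (N * i) * B\<^sup>2"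
     "q ^ (Suc N * Suc i) = q ^ (N * i) * B * T * q" "q ^ Suc N = q * B"
    by (simp_all add: B_def T_def power_add power2_eq_square)
  have fpos: "qfact i \<noteq> 0" "qfact N \<noteq> 0" "qfact (N + i) \<noteq> 0"
    using qfact_pos by (metis less_irrefl)+
  have "hermite_moment N i = C / (1 + B)"
    by (simp add: hermite_moment_def C_def B_def)
  moreover have "hermite_moment N (Suc i) = C * B * (1 - q * T\<^sup>2) * (1 - q\<^sup>2 * T\<^sup>2) /
      ((1 + B) * (1 - q * T) * (1 - q * B * T))"
    unfolding hermite_moment_def C_def qf2 qf4 pw2 B_def[symmetric] using fpos pos nz by (simp add: divide_simps)
  moreover have "hermite_moment N (Suc (Suc i)) =
      C * B\<^sup>2 * (1 - q * T\<^sup>2) * (1 - q\<^sup>2 * T\<^sup>2) * (1 - q ^ 3 * T\<^sup>2) * (1 - q ^ 4 * T\<^sup>2) /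
      ((1 + B) * (1 - q * T) * (1 - q\<^sup>2 * T) * (1 - q * B * T) * (1 - q\<^sup>2 * B * T))"
    unfolding hermite_moment_def C_def qf3 qf4 pw2 B_def[symmetric] using fpos pos nz by (simp add: divide_simps)
  moreover have "hermite_moment (Suc N) (Suc i) =
      C * (1 - q * B\<^sup>2) * (1 - q\<^sup>2 * B\<^sup>2) * (1 - q * T\<^sup>2) * (1 - q\<^sup>2 * T\<^sup>2) * B * q * T /
      ((1 + q * B) * (1 - q * B) * (1 - q * T) * (1 - q * B * T) * (1 - q\<^sup>2 * B * T))"
    unfolding hermite_moment_def C_def qf1 qf2 qf4 pw2 using fpos pos nz by (simp add: divide_simps)
  moreover have "C * (1 - q * B\<^sup>2) * (1 - q\<^sup>2 * B\<^sup>2) * (1 - q * T\<^sup>2) * (1 - q\<^sup>2 * T\<^sup>2) * B * q * T /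
      ((1 + q * B) * (1 - q * B) * (1 - q * T) * (1 - q * B * T) * (1 - q\<^sup>2 * B * T)) =
     ((1 + B)\<^sup>2 - B * (2 - q ^ 3 * T\<^sup>2 - q\<^sup>2 * T\<^sup>2)) * (C * B * (1 - q * T\<^sup>2) * (1 - q\<^sup>2 * T\<^sup>2) /
      ((1 + B) * (1 - q * T) * (1 - q * B * T))) -
     B * (C * B\<^sup>2 * (1 - q * T\<^sup>2) * (1 - q\<^sup>2 * T\<^sup>2) * (1 - q ^ 3 * T\<^sup>2) * (1 - q ^ 4 * T\<^sup>2) /
      ((1 + B) * (1 - q * T) * (1 - q\<^sup>2 * T) * (1 - q * B * T) * (1 - q\<^sup>2 * B * T))) -
     B * ((1 - q\<^sup>2 * T\<^sup>2) * (1 - q * T\<^sup>2)) * (C / (1 + B))"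
    using nz pos by (simp add: divide_simps) algebra
  moreover have "q ^ (2 * Suc i + 1) = q ^ 3 * T\<^sup>2" "q ^ (2 * Suc i) = q\<^sup>2 * T\<^sup>2" "q ^ (2 * Suc i - 1) = q * T\<^sup>2"
    using pw by (simp_all add: power2_eq_square power3_eq_cube)
  ultimately show ?thesis by (simp only: B_def)
qed

definition hermite_integral :: "nat \<Rightarrow> nat \<Rightarrow> real" where
  "hermite_integral N n = integral {0..pi} (\<lambda>t. q_hermite n (cos t) q * vweight_fin N t)"

lemma hermite_integral_Suc:
  "hermite_integral (Suc N) n =
     ((1 + q ^ N)\<^sup>2 - q ^ N * (2 - q ^ (n + 1) - q ^ n)) * hermite_integral N n
     - q ^ N * hermite_integral N (n + 2)
     - q ^ N * ((1 - q ^ n) * (1 - q ^ (n - 1))) * hermite_integral N (n - 2)"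
proof -
  define f where "f = (\<lambda>n t. q_hermite n (cos t) q * vweight_fin N t)"
  have f: "(f n has_integral hermite_integral N n) {0..pi}" for n
    unfolding hermite_integral_def f_def
    by (intro integrable_integral integrable_continuous_real continuous_intros continuous_on_vweight_fin)
  have "q_hermite n (cos t) q * vweight_fin (Suc N) t =
      ((1 + q ^ N)\<^sup>2 - q ^ N * (2 - q ^ (n + 1) - q ^ n)) * f n t
      - q ^ N * f (n + 2) t - q ^ N * ((1 - q ^ n) * (1 - q ^ (n - 1))) * f (n - 2) t" for t
  proof -
    have "q_hermite n (cos t) q * vweight_fin (Suc N) t =
        (1 + q ^ N)\<^sup>2 * f n t - q ^ N * (4 * (cos t)\<^sup>2 * q_hermite n (cos t) q) * vweight_fin N t"
      by (simp add: vweight_fin_Suc f_def algebra_simps)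
    then show ?thesis
      unfolding q_hermite_mult_4_sq by (simp add: f_def algebra_simps)
  qed
  then show ?thesis
    unfolding hermite_integral_def[of "Suc N"]
    by (intro integral_unique) (simp only:, intro has_integral_diff has_integral_mult_right f)
qed

text \<open>Both sides agree for N = 0 and obey the same recurrence in \<open>N\<close>, which
  preserves the parity of the degree.\<close>

lemma hermite_integral_eq:
  "hermite_integral N n = (if even n then hermite_moment N (n div 2) else 0)"
proof (induction N arbitrary: n)
  case 0
  show ?case
    using has_integral_q_hermite[of n]
    by (auto simp: hermite_integral_def hermite_moment_def power2_eq_square has_integral_iff)
next
  case (Suc N)
  show ?case
  proof (cases "even n")
    case True
    then obtain j where j: "n = 2 * j" by blast
    show ?thesis
    proof (cases j)
      case 0
      then show ?thesis
        unfolding hermite_integral_Suc[of N] Suc j by (simp add: hermite_moment_Suc_0 algebra_simps)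
    next
      case (Suc i)
      have "n - 2 = 2 * i" "n + 2 = 2 * Suc (Suc i)" "n = 2 * Suc i" using j Suc by auto
      then show ?thesis
        unfolding hermite_integral_Suc[of N] Suc.IH by (simp add: hermite_moment_Suc_Suc[of N i])
    qed
  next
    case False
    \<comment> \<open>For n = 1 the truncated index n - 2 is the even number 0, but its coefficient
      contains 1 - q^0 = 0.\<close>
    then have "n = 1 \<or> odd (n - 2)" by (cases "n = 1") presburger+
    then show ?thesis
      unfolding hermite_integral_Suc[of N] Suc using False by auto
  qed
qed

section \<open>From the truncated to the full weight\<close>

lemma norm_q: "norm (complex_of_real q) < 1" "norm q < 1"
  using q_pos q_less_1 by auto

lemma qfact_LIMSEQ: "qfact \<longlonglongrightarrow> qpochhammer_inf q q"
  using qpochhammer_LIMSEQ[OF norm_q(2), of q] .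

lemma qpochhammer_inf_q_nonzero: "qpochhammer_inf q q \<noteq> 0"
proof -
  have "q * q ^ j \<noteq> 1" for j using q_power_less_1[of j] by simp
  then show ?thesis using qpochhammer_inf_eq_0_iff[OF norm_q(2)] by blast
qed

lemma continuous_on_vweight: "continuous_on A vweight"
proof -
  have "continuous_on A (\<lambda>t. qpochhammer_inf (cis (2 * t)) (of_real q))"
    by (rule continuous_on_compose2[OF continuous_on_qpochhammer_inf[OF norm_q(1), of UNIV]])
       (auto intro!: continuous_intros)
  then show ?thesis
    unfolding vweight_def[abs_def] by (intro continuous_intros)
qed

lemma vweight_nonneg: "0 \<le> vweight t"
  by (simp add: vweight_def)

definition nu :: real where "nu = qpochhammer_inf q q / (2 * pi)"

text \<open>The factor q^(Nj) kills every j > 0. The convention 0^0 = 1 lets one limit computation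
  cover both cases.\<close>

lemma hermite_moment_LIMSEQ:
  "(\<lambda>N. hermite_moment N j) \<longlonglongrightarrow> (if j = 0 then 2 * pi / qpochhammer_inf q q else 0)"
proof -
  let ?P = "qpochhammer_inf q q"
  have sub: "strict_mono (\<lambda>N::nat. 2 * N)" "strict_mono (\<lambda>N::nat. N + j)"
    by (auto simp: strict_mono_def)
  have q0: "(\<lambda>N. q ^ N) \<longlonglongrightarrow> 0" using norm_q(2) by (rule LIMSEQ_power_zero)
  have l1: "(\<lambda>N. qfact (2 * N)) \<longlonglongrightarrow> ?P" "(\<lambda>N. qfact (N + j)) \<longlonglongrightarrow> ?P"
    using LIMSEQ_subseq_LIMSEQ[OF qfact_LIMSEQ sub(1)] LIMSEQ_subseq_LIMSEQ[OF qfact_LIMSEQ sub(2)]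
    by (simp_all add: o_def)
  have "(\<lambda>N. hermite_moment N j) \<longlonglongrightarrow>
      2 * pi * ?P * qfact (2 * j) * 0 ^ j / ((1 + 0) * ?P * qfact j * ?P)"
    unfolding hermite_moment_def power_mult
    by (intro tendsto_intros l1 qfact_LIMSEQ q0) (use qpochhammer_inf_q_nonzero qfact_pos[of j] in auto)
  then show ?thesis
    using qpochhammer_inf_q_nonzero by (cases "j = 0") (auto simp: zero_power)
qed

text \<open>Dominated convergence in the number of factors; the products (e^(2it);q)_N are bounded
  by \<open>K\<close> uniformly in N and t.\<close>

lemma integral_q_hermite_vweight:
  "nu * integral {0..pi} (\<lambda>t. q_hermite n (cos t) q * vweight t) = (if n = 0 then 1 else 0)"
proof -
  define K where "K = exp (1 / (1 - q))"
  have "(\<lambda>N. hermite_integral N n) \<longlonglongrightarrow> integral {0..pi} (\<lambda>t. q_hermite n (cos t) q * vweight t)"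
    unfolding hermite_integral_def
  proof (rule dominated_convergence(2)[where h = "\<lambda>t. \<bar>q_hermite n (cos t) q\<bar> * K\<^sup>2"])
    show "(\<lambda>t. q_hermite n (cos t) q * vweight_fin N t) integrable_on {0..pi}" for N
      by (intro integrable_continuous_real continuous_intros continuous_on_vweight_fin)
    show "(\<lambda>t. \<bar>q_hermite n (cos t) q\<bar> * K\<^sup>2) integrable_on {0..pi}"
      by (intro integrable_continuous_real continuous_intros)
    have "vweight_fin N t \<le> K\<^sup>2" for N t
      unfolding vweight_fin_def using norm_qpochhammer_le[OF norm_q(1), of "cis (2 * t)" N] q_pos
      by (intro power_mono) (auto simp: K_def)
    then show "norm (q_hermite n (cos t) q * vweight_fin N t) \<le> \<bar>q_hermite n (cos t) q\<bar> * K\<^sup>2" for N t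
      unfolding norm_mult by (intro mult_mono) (auto simp: vweight_fin_def)
    show "(\<lambda>N. q_hermite n (cos t) q * vweight_fin N t) \<longlonglongrightarrow> q_hermite n (cos t) q * vweight t" for t
      unfolding vweight_fin_def vweight_def by (intro tendsto_intros qpochhammer_LIMSEQ norm_q)
  qed
  moreover have "(\<lambda>N. hermite_integral N n) \<longlonglongrightarrow> (if n = 0 then 2 * pi / qpochhammer_inf q q else 0)"
    using hermite_moment_LIMSEQ[of "n div 2"] by (cases "even n") (auto simp: hermite_integral_eq elim!: evenE)
  ultimately have "integral {0..pi} (\<lambda>t. q_hermite n (cos t) q * vweight t) =
      (if n = 0 then 2 * pi / qpochhammer_inf q q else 0)"
    using LIMSEQ_unique by blast
  then show ?thesis
    using qpochhammer_inf_q_nonzero by (simp add: nu_def)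
qed

end


section \<open>The functional without theta factor\<close>

lemma sum_power_le:
  fixes q :: real
  assumes "0 \<le> q" "q < 1"
  shows "(\<Sum>k<n. q ^ k) \<le> 1 / (1 - q)"
proof -
  have "(\<Sum>k<n. q ^ k) \<le> (\<Sum>k. q ^ k)"
    using assms by (intro sum_le_suminf summable_geometric) auto
  also have "\<dots> = 1 / (1 - q)"
    using assms by (intro suminf_geometric) auto
  finally show ?thesis .
qed

text \<open>The constant is uniform in \<open>t\<close> and \<open>b\<close> because the estimate is
  used along a whole orbit b, bq, bq^2, ... at once; \<kappa> is arbitrary so that (1 + \<kappa>)|b|
  can be kept below 1.\<close>

lemma al_salam_chihara_growth:
  assumes q: "0 \<le> q" "q < 1" and \<kappa>: "0 < \<kappa>"
  shows "\<exists>C>0. \<forall>n t b. \<bar>b\<bar> \<le> 1 \<longrightarrow> \<bar>al_salam_chihara n (cos t) 0 b q\<bar> \<le> C * (1 + \<kappa>) ^ n"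
proof (intro exI conjI allI impI)
  \<comment> \<open>Chosen so that \<open>2 * cmod (h n) + d n \<le> s * Y n\<close>.\<close>
  define s where "s = 2 / \<kappa> + 1"
  show "0 < (\<kappa> + 2) * exp (s / (1 - q)) / \<kappa>" using \<kappa> by simp
  fix n and t b :: real assume b: "\<bar>b\<bar> \<le> 1"
  define z where "z = cis t"
  define h where "h = (\<lambda>n. complex_of_real (al_salam_chihara n (cos t) 0 b q))"
  define d where "d = (\<lambda>n. cmod (h (Suc n) - z * h n))"
  \<comment> \<open>The limiting recurrence has the characteristic roots \<open>z\<close> and \<open>1/z\<close>, so up to \<open>O(q\<^sup>n)\<close> the size of
    \<open>h (n+1) - z h n\<close> is conserved; weighting \<open>h\<close> by \<open>\<kappa>\<close> absorbs the resonance at \<open>z = \<plusminus>1\<close>.\<close>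
  define Y where "Y = (\<lambda>n. \<kappa> * cmod (h n) + d n)"
  have z: "z + cnj z = of_real (2 * cos t)" "z * cnj z = 1" "cmod z = 1" "cmod (cnj z) = 1"
    by (auto simp: z_def complex_eq_iff cis_cnj cis_mult)
  have Y0: "Y n \<ge> 0" for n using \<kappa> by (auto simp: Y_def d_def)
  have step: "Y (Suc n) \<le> (1 + \<kappa>) * (1 + s * q ^ n) * Y n" for n
  proof -
    have h2: "h (Suc (Suc n)) = (z + cnj z - of_real (b * q ^ Suc n)) * h (Suc n) - (1 - of_real (q ^ Suc n)) * h n"
      unfolding z by (simp add: h_def)
    \<comment> \<open>The last summand is zero; writing it out makes this a polynomial identity,
      independent of |z| = 1.\<close>
    have "h (Suc (Suc n)) - z * h (Suc n) =
        cnj z * (h (Suc n) - z * h n) + of_real (q ^ Suc n) * (h n - of_real b * h (Suc n)) + (z * cnj z - 1) * h n"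
      unfolding h2 by (simp add: algebra_simps)
    then have "d (Suc n) = cmod (cnj z * (h (Suc n) - z * h n) + of_real (q ^ Suc n) * (h n - of_real b * h (Suc n)))"
      unfolding d_def z(2) by simp
    also have "\<dots> \<le> d n + q ^ Suc n * cmod (h n - of_real b * h (Suc n))"
      using q by (intro order.trans[OF norm_triangle_ineq]) (simp add: norm_mult norm_power z(3) d_def)
    also have "cmod (h n - of_real b * h (Suc n)) \<le> cmod (h n) + cmod (h (Suc n))"
      using b by (intro order.trans[OF norm_triangle_ineq4]) (simp add: norm_mult mult_left_le_one_le)
    also have hs: "cmod (h (Suc n)) \<le> cmod (h n) + d n"
      unfolding d_def using norm_triangle_sub[of "h (Suc n)" "z * h n"] z(3) by (simp add: norm_mult)
    finally have "d (Suc n) \<le> d n + q ^ Suc n * (cmod (h n) + (cmod (h n) + d n))"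
      using q by (simp add: mult_left_mono)
    also have "\<dots> \<le> d n + q ^ n * (2 * cmod (h n) + d n)"
      using q by (intro add_left_mono mult_mono) (auto simp: mult_left_le_one_le d_def)
    also have "2 * cmod (h n) + d n \<le> s * Y n"
      using \<kappa> by (simp add: s_def Y_def d_def field_simps)
    finally have "d (Suc n) \<le> d n + q ^ n * (s * Y n)"
      using q by (simp add: mult_left_mono)
    moreover have "\<kappa> * cmod (h (Suc n)) \<le> \<kappa> * (cmod (h n) + d n)"
      using hs \<kappa> by simp
    ultimately have "Y (Suc n) \<le> \<kappa> * cmod (h n) + \<kappa> * d n + d n + q ^ n * (s * Y n)"
      by (simp add: Y_def algebra_simps)
    also have "\<dots> \<le> (1 + \<kappa>) * Y n + (1 + \<kappa>) * (q ^ n * (s * Y n))"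
    proof (intro add_mono)
      show "\<kappa> * cmod (h n) + \<kappa> * d n + d n \<le> (1 + \<kappa>) * Y n"
        using \<kappa> by (simp add: Y_def algebra_simps)
      have "0 \<le> q ^ n * (s * Y n)" using q \<kappa> Y0[of n] by (simp add: s_def)
      then show "q ^ n * (s * Y n) \<le> (1 + \<kappa>) * (q ^ n * (s * Y n))"
        using \<kappa> by (simp add: algebra_simps)
    qed
    finally show ?thesis by (simp add: algebra_simps)
  qed
  have s: "0 \<le> s" using \<kappa> by (simp add: s_def)
  \<comment> \<open>The factors 1 + s q^k have a bounded product, so only the powers of 1 + \<kappa>
    remain.\<close>
  have "Y n \<le> (\<kappa> + 2) * (1 + \<kappa>) ^ n * (\<Prod>k<n. 1 + s * q ^ k)"
  proof (induction n)
    case 0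
    have "h (Suc 0) - z * h 0 = cnj z - of_real b"
      using z(1) by (simp add: h_def algebra_simps)
    then have "d 0 \<le> 2"
      unfolding d_def using norm_triangle_ineq4[of "cnj z" "of_real b"] z(4) b by simp
    then show ?case by (simp add: Y_def h_def)
  next
    case (Suc n)
    have "Y (Suc n) \<le> (1 + \<kappa>) * (1 + s * q ^ n) * Y n" by (rule step)
    also have "\<dots> \<le> (1 + \<kappa>) * (1 + s * q ^ n) * ((\<kappa> + 2) * (1 + \<kappa>) ^ n * (\<Prod>k<n. 1 + s * q ^ k))"
      using Suc \<kappa> s q by (intro mult_left_mono) auto
    finally show ?case by (simp add: mult_ac)
  qed
  also have "(\<Prod>k<n. 1 + s * q ^ k) \<le> exp (\<Sum>k<n. s * q ^ k)"
    using s q by (intro prod_le_exp_sum) auto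
  also have "(\<Sum>k<n. s * q ^ k) = s * (\<Sum>k<n. q ^ k)"
    by (simp add: sum_distrib_left)
  also have "\<dots> \<le> s * (1 / (1 - q))"
    using s q by (intro mult_left_mono sum_power_le) auto
  finally have "Y n \<le> (\<kappa> + 2) * (1 + \<kappa>) ^ n * exp (s / (1 - q))"
    using \<kappa> by (simp add: mult_left_mono)
  moreover have "\<kappa> * \<bar>al_salam_chihara n (cos t) 0 b q\<bar> \<le> Y n"
    by (simp add: Y_def h_def d_def)
  ultimately show "\<bar>al_salam_chihara n (cos t) 0 b q\<bar> \<le> (\<kappa> + 2) * exp (s / (1 - q)) / \<kappa> * (1 + \<kappa>) ^ n"
    using \<kappa> by (simp add: field_simps)
qed

section \<open>The weight factor R(c) and the functional L(c,b)\<close>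

context q_unit
begin

definition rfac :: "real \<Rightarrow> real \<Rightarrow> real" where
  "rfac c t = (cmod (qpochhammer_inf (of_real c * cis t) (of_real q)))\<^sup>2"

lemma rfac_rec: "rfac c t = (1 + c\<^sup>2 - 2 * c * cos t) * rfac (c * q) t"
proof -
  have "qpochhammer_inf (of_real c * cis t) (complex_of_real q) =
      (1 - of_real c * cis t) * qpochhammer_inf (of_real (c * q) * cis t) (of_real q)"
    using qpochhammer_inf_rec[OF norm_q(1), of "of_real c * cis t"] by (simp add: mult_ac)
  then show ?thesis
    unfolding rfac_def by (simp only: norm_mult[of "1 - _"] power_mult_distrib cmod_1_minus_cis)
qed

lemma rfac_0 [simp]: "rfac 0 t = 1"
  by (simp add: rfac_def qpochhammer_inf_def)

lemma rfac_nonneg: "0 \<le> rfac c t"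
  by (simp add: rfac_def)

lemma rfac_pos:
  assumes "\<bar>c\<bar> < 1"
  shows "0 < rfac c t"
proof -
  have "of_real c * cis t * of_real q ^ j \<noteq> 1" for j
  proof
    assume "of_real c * cis t * of_real q ^ j = (1::complex)"
    then have "cmod (of_real c * cis t * of_real q ^ j) = 1" by simp
    then have "\<bar>c\<bar> * q ^ j = 1" using q_pos by (simp add: norm_mult norm_power)
    moreover have "\<bar>c\<bar> * q ^ j \<le> \<bar>c\<bar>" using q_pos q_less_1 by (simp add: mult_left_le power_le_one)
    ultimately show False using assms by simp
  qed
  then show ?thesis
    unfolding rfac_def using qpochhammer_inf_eq_0_iff[OF norm_q(1)] by simp
qed

text \<open>R(c) tends to 1 uniformly in t as c tends to 0: the difference |x|^2 - 1 factors into
  |x| - 1 and |x| + 1, each controlled by the product bounds.\<close>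

lemma rfac_minus_1: "\<bar>rfac c t - 1\<bar> \<le> exp (2 * \<bar>c\<bar> / (1 - q)) - 1"
proof -
  define x where "x = qpochhammer_inf (of_real c * cis t) (complex_of_real q)"
  define e where "e = exp (\<bar>c\<bar> / (1 - q))"
  have x: "cmod (x - 1) \<le> e - 1" "cmod x \<le> e"
    using norm_qpochhammer_inf_minus_1[OF norm_q(1), of "of_real c * cis t"]
      norm_qpochhammer_inf_le[OF norm_q(1), of "of_real c * cis t"] q_pos
    by (simp_all add: x_def e_def norm_mult)
  have "\<bar>cmod x - 1\<bar> \<le> e - 1"
    using norm_triangle_ineq3[of x 1] x(1) by simp
  then have "\<bar>cmod x - 1\<bar> * (cmod x + 1) \<le> (e - 1) * (e + 1)"
    using x(2) by (intro mult_mono) auto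
  moreover have "rfac c t - 1 = (cmod x - 1) * (cmod x + 1)"
    by (simp add: rfac_def x_def power2_eq_square algebra_simps)
  then have "\<bar>rfac c t - 1\<bar> = \<bar>cmod x - 1\<bar> * (cmod x + 1)"
    by (simp add: abs_mult)
  moreover have "(e - 1) * (e + 1) = exp (2 * \<bar>c\<bar> / (1 - q)) - 1"
    unfolding e_def by (simp add: algebra_simps exp_add[symmetric] add_divide_distrib[symmetric])
  ultimately show ?thesis by simp
qed

lemma continuous_on_rfac [continuous_intros]:
  assumes "continuous_on A f" "continuous_on A g"
  shows "continuous_on A (\<lambda>s. rfac (f s) (g s))"
proof -
  have "continuous_on A (\<lambda>s. qpochhammer_inf (of_real (f s) * cis (g s)) (complex_of_real q))"
    by (rule continuous_on_compose2[OF continuous_on_qpochhammer_inf[OF norm_q(1), of UNIV]])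
       (auto intro!: continuous_intros assms)
  then show ?thesis
    unfolding rfac_def[abs_def] by (intro continuous_intros)
qed

lemma continuous_on_vweight' [continuous_intros]:
  "continuous_on A g \<Longrightarrow> continuous_on A (\<lambda>s. vweight (g s))"
  using continuous_on_compose2[OF continuous_on_vweight[of UNIV]] by blast

text \<open>This is L(c,b). The argument is a function of x = cos t, so polynomial identities in x
  can be rewritten inside it.\<close>

definition funct :: "real \<Rightarrow> real \<Rightarrow> (real \<Rightarrow> real) \<Rightarrow> real" where
  "funct c b f = nu * integral {0..pi} (\<lambda>t. f (cos t) * (vweight t * rfac c t / rfac b t))"

lemma nu_pos: "0 < nu"
proof -
  have "0 \<le> qpochhammer_inf q q"
    using qfact_LIMSEQ by (rule LIMSEQ_le_const) (use qfact_pos less_imp_le in blast)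
  then show ?thesis using qpochhammer_inf_q_nonzero by (simp add: nu_def)
qed

lemma funct_integrable:
  assumes "continuous_on UNIV f" "\<bar>b\<bar> < 1"
  shows "(\<lambda>t. f (cos t) * (vweight t * rfac c t / rfac b t)) integrable_on {0..pi}"
proof -
  have "continuous_on {0..pi} (\<lambda>t. f (cos t))"
    by (rule continuous_on_compose2[OF assms(1)]) (auto intro!: continuous_intros)
  moreover have "rfac b t \<noteq> 0" for t using rfac_pos[OF assms(2), of t] by simp
  ultimately show ?thesis
    by (intro integrable_continuous_real continuous_intros) auto
qed

lemma funct_diff:
  assumes "continuous_on UNIV f" "continuous_on UNIV g" "\<bar>b\<bar> < 1"
  shows "funct c b (\<lambda>x. f x - g x) = funct c b f - funct c b g"
  using integral_diff[OF funct_integrable[OF assms(1,3)] funct_integrable[OF assms(2,3)], of c c]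
  unfolding funct_def left_diff_distrib by (simp only: right_diff_distrib)

lemma funct_add:
  assumes "continuous_on UNIV f" "continuous_on UNIV g" "\<bar>b\<bar> < 1"
  shows "funct c b (\<lambda>x. f x + g x) = funct c b f + funct c b g"
  using integral_add[OF funct_integrable[OF assms(1,3)] funct_integrable[OF assms(2,3)], of c c]
  unfolding funct_def distrib_right by (simp only: distrib_left)

lemma funct_cmult: "funct c b (\<lambda>x. k * f x) = k * funct c b f"
  by (simp only: funct_def mult.assoc[of k] integral_mult_right mult.left_commute[of nu k])

lemma funct_shift_numerator:
  "funct c b f = funct (c * q) b (\<lambda>x. (1 + c\<^sup>2 - 2 * c * x) * f x)"
  unfolding funct_def by (subst rfac_rec) (simp add: mult_ac)

lemma funct_shift_denominator:
  assumes "\<bar>b\<bar> < 1"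
  shows "funct c (b * q) f = funct c b (\<lambda>x. (1 + b\<^sup>2 - 2 * b * x) * f x)"
proof -
  have "vweight t * rfac c t / rfac (b * q) t = (1 + b\<^sup>2 - 2 * b * cos t) * (vweight t * rfac c t / rfac b t)" for t
    using rfac_pos[OF assms, of t] unfolding rfac_rec[of b] by auto
  then show ?thesis by (simp add: funct_def mult_ac)
qed

lemma funct_abs_le:
  assumes f: "continuous_on UNIV f" and b: "\<bar>b\<bar> < 1"
    and C: "\<And>t. \<bar>f (cos t)\<bar> \<le> C"
  shows "\<bar>funct c b f\<bar> \<le> C * funct c b (\<lambda>_. 1)"
proof -
  let ?w = "\<lambda>t. vweight t * rfac c t / rfac b t"
  have w: "0 \<le> ?w t" for t using vweight_nonneg rfac_nonneg by simp
  have w_int: "?w integrable_on {0..pi}" using funct_integrable[OF _ b, of "\<lambda>_. 1" c] by simp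
  have "norm (integral {0..pi} (\<lambda>t. f (cos t) * ?w t)) \<le> integral {0..pi} (\<lambda>t. C * ?w t)"
  proof (rule integral_norm_bound_integral[OF funct_integrable[OF f b]])
    show "(\<lambda>t. C * ?w t) integrable_on {0..pi}"
      using w_int by (rule integrable_on_mult_right)
    show "norm (f (cos t) * ?w t) \<le> C * ?w t" for t
      using C[of t] w[of t] unfolding real_norm_def abs_mult abs_of_nonneg[OF w] by (intro mult_right_mono)
  qed
  then have "nu * \<bar>integral {0..pi} (\<lambda>t. f (cos t) * ?w t)\<bar> \<le> nu * (C * integral {0..pi} ?w)"
    using nu_pos unfolding integral_mult_right real_norm_def by (intro mult_left_mono) auto
  then show ?thesis
    using nu_pos by (simp add: funct_def abs_mult mult.left_commute[of C])
qed

text \<open>The two weights differ by the factor R(c) - 1. The explicit bound, unlike a mere limit,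
  allows \<open>f\<close> to vary together with \<open>c\<close>.\<close>

lemma funct_abs_diff_le:
  assumes f: "continuous_on UNIV f" and b: "\<bar>b\<bar> < 1"
    and C: "\<And>t. \<bar>f (cos t)\<bar> \<le> C"
  shows "\<bar>funct c b f - funct 0 b f\<bar> \<le> C * (exp (2 * \<bar>c\<bar> / (1 - q)) - 1) * funct 0 b (\<lambda>_. 1)"
proof -
  let ?w = "\<lambda>t. vweight t * rfac 0 t / rfac b t"
  define e where "e = exp (2 * \<bar>c\<bar> / (1 - q)) - 1"
  have w: "0 \<le> ?w t" for t using vweight_nonneg rfac_nonneg by simp
  have w_int: "?w integrable_on {0..pi}" using funct_integrable[OF _ b, of "\<lambda>_. 1" 0] by simp
  have eq: "f (cos t) * (vweight t * rfac c t / rfac b t) - f (cos t) * ?w t = (f (cos t) * (rfac c t - 1)) * ?w t" for t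
    by (simp add: algebra_simps diff_divide_distrib)
  have "integral {0..pi} (\<lambda>t. f (cos t) * (vweight t * rfac c t / rfac b t)) - integral {0..pi} (\<lambda>t. f (cos t) * ?w t)
      = integral {0..pi} (\<lambda>t. (f (cos t) * (rfac c t - 1)) * ?w t)"
    unfolding eq[symmetric] by (rule integral_diff[symmetric]) (intro funct_integrable f b)+
  moreover have "norm (integral {0..pi} (\<lambda>t. (f (cos t) * (rfac c t - 1)) * ?w t)) \<le> integral {0..pi} (\<lambda>t. (C * e) * ?w t)"
  proof (rule integral_norm_bound_integral)
    show "(\<lambda>t. (f (cos t) * (rfac c t - 1)) * ?w t) integrable_on {0..pi}"
      unfolding eq[symmetric] by (intro integrable_diff funct_integrable f b)
    show "(\<lambda>t. (C * e) * ?w t) integrable_on {0..pi}"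
      using w_int by (rule integrable_on_mult_right)
    show "norm ((f (cos t) * (rfac c t - 1)) * ?w t) \<le> (C * e) * ?w t" for t
    proof -
      have "\<bar>f (cos t)\<bar> * \<bar>rfac c t - 1\<bar> \<le> C * e"
        using C[of t] rfac_minus_1[of c t] order.trans[OF abs_ge_zero C[of t]] unfolding e_def by (intro mult_mono) auto
      then show ?thesis
        using w[of t] unfolding real_norm_def abs_mult abs_of_nonneg[OF w] by (intro mult_right_mono)
    qed
  qed
  ultimately have "nu * \<bar>integral {0..pi} (\<lambda>t. f (cos t) * (vweight t * rfac c t / rfac b t)) - integral {0..pi} (\<lambda>t. f (cos t) * ?w t)\<bar>
     \<le> nu * integral {0..pi} (\<lambda>t. (C * e) * ?w t)"
    using nu_pos by (intro mult_left_mono) auto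
  then show ?thesis
    using nu_pos unfolding funct_def e_def[symmetric] right_diff_distrib[symmetric] abs_mult integral_mult_right
    by (simp add: mult_ac)
qed

text \<open>Continuity of a parameter integral over a compact interval. It justifies the limits
  along geometric orbits of \<open>b\<close> and of \<open>a\<close>.\<close>

lemma continuous_on_funct:
  assumes f: "continuous_on (U \<times> UNIV) (\<lambda>(s, x). f s x)"
    and \<beta>: "continuous_on U \<beta>" "\<And>s. s \<in> U \<Longrightarrow> \<bar>\<beta> s\<bar> < 1"
  shows "continuous_on (U :: real set) (\<lambda>s. funct c (\<beta> s) (f s))"
proof -
  have "continuous_on (U \<times> cbox 0 pi) (\<lambda>(s, t). f s (cos t) * (vweight t * rfac c t / rfac (\<beta> s) t))"
    unfolding split_beta
  proof (intro continuous_intros)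
    show "continuous_on (U \<times> cbox 0 pi) (\<lambda>p. f (fst p) (cos (snd p)))"
    proof -
      have "continuous_on (U \<times> cbox 0 pi) (\<lambda>p::real \<times> real. (fst p, cos (snd p)))"
        by (intro continuous_intros)
      from continuous_on_compose2[OF f this] show ?thesis by (auto simp: image_subset_iff)
    qed
    show "continuous_on (U \<times> cbox 0 pi) (\<lambda>p. \<beta> (fst p))"
      by (rule continuous_on_compose2[OF \<beta>(1)]) (auto intro!: continuous_intros)
    show "\<forall>p\<in>U \<times> cbox 0 pi. rfac (\<beta> (fst p)) (snd p) \<noteq> 0"
    proof
      fix p assume "p \<in> U \<times> cbox 0 pi"
      then have "\<bar>\<beta> (fst p)\<bar> < 1" using \<beta>(2) by auto
      from rfac_pos[OF this, of "snd p"] show "rfac (\<beta> (fst p)) (snd p) \<noteq> 0" by simp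
    qed
  qed
  from integral_continuous_on_param[OF this] show ?thesis
    unfolding funct_def by (intro continuous_intros) simp
qed

section \<open>Moments of the functional L(0,b)\<close>

lemma orbit_le: "\<bar>b * q ^ i\<bar> \<le> \<bar>b\<bar>"
  using q_pos q_less_1 by (simp add: abs_mult mult_left_le power_le_one)

lemma orbit_LIMSEQ: "(\<lambda>i. b * q ^ i) \<longlonglongrightarrow> 0"
  using tendsto_mult_right_zero[OF LIMSEQ_power_zero[OF norm_q(2)]] .

text \<open>Telescoping in \<open>i\<close> expresses row j + 1 as a sum over row j + 2 weighted by
  b q^(i+l). Repeating this k times improves the bound to one of order (\<rho>|b|q^i)^k / (q;q)_k,
  which tends to 0.\<close>

lemma orbit_system_zero:
  fixes M :: "nat \<Rightarrow> nat \<Rightarrow> real"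
  assumes rec: "\<And>i j. M i (Suc j) = M (Suc i) (Suc j) + b * q ^ i * M i (Suc (Suc j))"
    and lim: "\<And>j. (\<lambda>i. M i (Suc j)) \<longlonglongrightarrow> 0"
    and bound: "\<And>i j. \<bar>M i (Suc j)\<bar> \<le> C * \<rho> ^ j"
    and \<rho>: "0 \<le> \<rho>" "\<rho> * \<bar>b\<bar> < 1"
  shows "M i (Suc j) = 0"
proof -
  have "\<bar>M i (Suc j)\<bar> \<le> C * \<rho> ^ (j + k) * (\<bar>b\<bar> * q ^ i) ^ k / qfact k" for k
  proof (induction k arbitrary: i j)
    case 0
    then show ?case using bound by simp
  next
    case (Suc k)
    \<comment> \<open>\<open>D\<close> is the bound for the term l = 0; the following terms decay
      with ratio q^(k+1), whose geometric sum supplies the next factor of (q;q)_(k+1).\<close>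
    define D where "D = C * \<rho> ^ (j + Suc k) * (\<bar>b\<bar> * q ^ i) ^ Suc k / qfact k"
    have "\<bar>M (i + l) (Suc (Suc j))\<bar> * \<bar>b * q ^ (i + l)\<bar> \<le> D * (q ^ Suc k) ^ l" for l
    proof -
      have "\<bar>M (i + l) (Suc (Suc j))\<bar> * \<bar>b * q ^ (i + l)\<bar> \<le>
          C * \<rho> ^ (Suc j + k) * (\<bar>b\<bar> * q ^ (i + l)) ^ k / qfact k * \<bar>b * q ^ (i + l)\<bar>"
        by (intro mult_right_mono Suc) auto
      also have "\<dots> = C * \<rho> ^ (j + Suc k) * (\<bar>b\<bar> * q ^ (i + l)) ^ Suc k / qfact k"
        using q_pos by (simp add: abs_mult)
      also have "\<dots> = D * (q ^ Suc k) ^ l"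
        by (simp add: D_def power_add power_mult_distrib power_mult[symmetric] mult_ac)
      finally show ?thesis .
    qed
    note trm = this
    have D0: "0 \<le> D" using order.trans[OF _ trm[of 0]] by simp
    have "\<bar>M i (Suc j)\<bar> \<le> \<bar>M (i + N) (Suc j)\<bar> + (\<Sum>l<N. D * (q ^ Suc k) ^ l)" for N
    proof (induction N)
      case (Suc N)
      have "M (i + N) (Suc j) = M (i + Suc N) (Suc j) + b * q ^ (i + N) * M (i + N) (Suc (Suc j))"
        using rec[of "i + N" j] by simp
      then have "\<bar>M (i + N) (Suc j)\<bar> \<le> \<bar>M (i + Suc N) (Suc j)\<bar> + \<bar>b * q ^ (i + N) * M (i + N) (Suc (Suc j))\<bar>"
        by linarith
      also have "\<bar>b * q ^ (i + N) * M (i + N) (Suc (Suc j))\<bar> \<le> D * (q ^ Suc k) ^ N"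
        using trm[of N] by (simp add: abs_mult mult.commute)
      finally show ?case using Suc by simp
    qed simp
    moreover have "(\<Sum>l<N. D * (q ^ Suc k) ^ l) \<le> D * (1 / (1 - q ^ Suc k))" for N
      unfolding sum_distrib_left[symmetric]
      by (intro mult_left_mono sum_power_le D0) (use q_pos q_power_less_1[of k] in auto)
    ultimately have "\<bar>M i (Suc j)\<bar> \<le> \<bar>M (i + N) (Suc j)\<bar> + D * (1 / (1 - q ^ Suc k))" for N
      by (meson add_left_mono order_trans)
    moreover have "(\<lambda>N. M (i + N) (Suc j)) \<longlonglongrightarrow> 0"
      using LIMSEQ_ignore_initial_segment[OF lim[of j], of i] by (simp only: add.commute)
    then have "(\<lambda>N. \<bar>M (i + N) (Suc j)\<bar> + D * (1 / (1 - q ^ Suc k))) \<longlonglongrightarrow> \<bar>0\<bar> + D * (1 / (1 - q ^ Suc k))"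
      by (intro tendsto_intros)
    ultimately have "\<bar>M i (Suc j)\<bar> \<le> D * (1 / (1 - q ^ Suc k))"
      by (intro LIMSEQ_le_const[where X = "\<lambda>N. \<bar>M (i + N) (Suc j)\<bar> + D * (1 / (1 - q ^ Suc k))"]) simp_all
    also have "\<dots> = C * \<rho> ^ (j + Suc k) * (\<bar>b\<bar> * q ^ i) ^ Suc k / qfact (Suc k)"
      by (simp add: D_def qfact_Suc)
    finally show ?case .
  qed
  moreover have "(\<lambda>k. C * \<rho> ^ j * (\<rho> * (\<bar>b\<bar> * q ^ i)) ^ k / qfact k) \<longlonglongrightarrow> C * \<rho> ^ j * 0 / qpochhammer_inf q q"
  proof (intro tendsto_intros qfact_LIMSEQ qpochhammer_inf_q_nonzero LIMSEQ_power_zero)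
    have "\<rho> * (\<bar>b\<bar> * q ^ i) \<le> \<rho> * \<bar>b\<bar>"
      using \<rho> orbit_le[of b i] q_pos by (intro mult_left_mono) (auto simp: abs_mult)
    then show "norm (\<rho> * (\<bar>b\<bar> * q ^ i)) < 1"
      using \<rho> q_pos by simp
  qed
  then have "(\<lambda>k. C * \<rho> ^ (j + k) * (\<bar>b\<bar> * q ^ i) ^ k / qfact k) \<longlonglongrightarrow> 0"
    by (simp add: power_add power_mult_distrib mult_ac)
  ultimately have "\<bar>M i (Suc j)\<bar> \<le> 0"
    by (intro LIMSEQ_le_const) auto
  then show ?thesis by simp
qed

lemma continuous_on_asc: "continuous_on A (\<lambda>x. al_salam_chihara n x a b q)"
  by (intro continuous_intros)

text \<open>Along the orbit b q^i the Christoffel formula gives the system of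
  \<open>orbit_system_zero\<close>, and its limit is the q-Hermite case. Row 0 is settled
  last.\<close>

lemma funct_big_q_hermite:
  assumes b: "\<bar>b\<bar> < 1"
  shows "funct 0 b (\<lambda>x. al_salam_chihara n x 0 b q) = (if n = 0 then 1 else 0)"
proof -
  define M where "M = (\<lambda>i j. funct 0 (b * q ^ i) (\<lambda>x. al_salam_chihara j x 0 (b * q ^ i) q))"
  have bi: "\<bar>b * q ^ i\<bar> < 1" for i
    using orbit_le b by (rule order.strict_trans1)
  have rec: "M i j = M (Suc i) j + b * q ^ i * M i (Suc j)" for i j
  proof -
    let ?b = "b * q ^ i"
    have "M (Suc i) j = funct 0 (?b * q) (\<lambda>x. al_salam_chihara j x 0 (?b * q) q)"
      by (simp add: M_def mult_ac)
    also have "\<dots> = funct 0 ?b (\<lambda>x. (1 + ?b\<^sup>2 - 2 * ?b * x) * al_salam_chihara j x (?b * q) 0 q)"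
      unfolding funct_shift_denominator[OF bi] al_salam_chihara_commute[of j _ 0] ..
    also have "\<dots> = M i j - b * q ^ i * M i (Suc j)"
      unfolding al_salam_chihara_christoffel M_def al_salam_chihara_commute[of _ _ 0]
      by (simp add: funct_diff[OF _ _ bi] funct_cmult continuous_intros)
    finally show ?thesis by simp
  qed
  have cont: "continuous_on {-\<bar>b\<bar>..\<bar>b\<bar>} (\<lambda>s. funct 0 s (f s))"
    if "continuous_on UNIV (\<lambda>p. f (fst p) (snd p))" for f
    using b by (intro continuous_on_funct) (auto simp: split_beta intro: continuous_on_subset[OF that])
  have "(\<lambda>i. M i j) \<longlonglongrightarrow> funct 0 0 (\<lambda>x. q_hermite j x q)" for j
    unfolding M_def
  proof (rule continuous_on_tendsto_compose[OF cont orbit_LIMSEQ])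
    show "continuous_on UNIV (\<lambda>p. al_salam_chihara j (snd p) 0 (fst p) q)"
      by (intro continuous_intros)
    show "\<forall>\<^sub>F i in sequentially. b * q ^ i \<in> {-\<bar>b\<bar>..\<bar>b\<bar>}"
      using orbit_le[of b] by (auto simp: abs_le_iff intro!: always_eventually) (smt (verit))+
  qed auto
  moreover have "funct 0 0 (\<lambda>x. q_hermite j x q) = (if j = 0 then 1 else 0)" for j
    using integral_q_hermite_vweight[of j] by (simp add: funct_def)
  ultimately have lim: "(\<lambda>i. M i j) \<longlonglongrightarrow> (if j = 0 then 1 else 0)" for j
    by metis
  \<comment> \<open>The total masses are bounded along the orbit by continuity on a compact
    parameter interval.\<close>
  have "compact ((\<lambda>s. funct 0 s (\<lambda>_. 1)) ` {-\<bar>b\<bar>..\<bar>b\<bar>})"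
    by (intro compact_continuous_image cont compact_Icc) auto
  then obtain B where B: "\<And>s. s \<in> {-\<bar>b\<bar>..\<bar>b\<bar>} \<Longrightarrow> \<bar>funct 0 s (\<lambda>_. 1)\<bar> \<le> B"
    using compact_imp_bounded bounded_iff by (metis (no_types, lifting) image_eqI real_norm_def)
  have B': "\<bar>funct 0 (b * q ^ i) (\<lambda>_. 1)\<bar> \<le> B" for i
    using orbit_le[of b i] by (intro B) auto
  obtain \<kappa> where \<kappa>: "0 < \<kappa>" "(1 + \<kappa>) * \<bar>b\<bar> < 1"
  proof
    show "0 < (1 - \<bar>b\<bar>) / 2" using b by simp
    have "(1 + (1 - \<bar>b\<bar>) / 2) * \<bar>b\<bar> = 1 - (1 - \<bar>b\<bar>) * (1 - \<bar>b\<bar> / 2)" by (simp add: field_simps)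
    also have "\<dots> < 1" using b by simp
    finally show "(1 + (1 - \<bar>b\<bar>) / 2) * \<bar>b\<bar> < 1" .
  qed
  obtain C where C: "C > 0" "\<And>n t b. \<bar>b\<bar> \<le> 1 \<Longrightarrow> \<bar>al_salam_chihara n (cos t) 0 b q\<bar> \<le> C * (1 + \<kappa>) ^ n"
    using al_salam_chihara_growth[of q \<kappa>] q_pos q_less_1 \<kappa>(1) by (metis less_imp_le)
  have "\<bar>M i (Suc j)\<bar> \<le> (C * (1 + \<kappa>) * B) * (1 + \<kappa>) ^ j" for i j
  proof -
    have "\<bar>M i (Suc j)\<bar> \<le> C * (1 + \<kappa>) ^ Suc j * funct 0 (b * q ^ i) (\<lambda>_. 1)"
      unfolding M_def using bi[of i] by (intro funct_abs_le C(2) bi continuous_on_asc) auto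
    also have "\<dots> \<le> C * (1 + \<kappa>) ^ Suc j * B"
      using C(1) \<kappa>(1) B'[of i] by (intro mult_left_mono) auto
    finally show ?thesis by (simp add: mult_ac)
  qed
  note bound = this
  have "(\<lambda>i. M i (Suc j)) \<longlonglongrightarrow> 0" for j
    using lim[of "Suc j"] by simp
  from orbit_system_zero[OF rec this bound] have zero: "M i (Suc j) = 0" for i j
    using \<kappa> by simp
  \<comment> \<open>With row 1 known to vanish, the relation makes row 0 constant in
    \<open>i\<close>, so it equals its limit 1.\<close>
  define m where "m = M 0 0"
  have "M i 0 = m" for i
  proof (induction i)
    case (Suc i)
    then show ?case using rec[of i 0] zero[of i 0] by simp
  qed (simp add: m_def)
  then have "(\<lambda>i::nat. m) \<longlonglongrightarrow> 1"
    using lim[of 0] by simp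
  then have "M 0 0 = 1"
    by (simp add: m_def LIMSEQ_const_iff)
  with zero[of 0] show ?thesis
    by (cases n) (auto simp: M_def)
qed

text \<open>Induction on the degree: by \<open>al_salam_chihara_shift_param\<close> the defect
  \<open>g\<close> between moment and claim is unchanged by a -> aq. Continuity then gives g(a) =
  g(0), which is the case a = 0 already known.\<close>

lemma funct_asc:
  assumes b: "\<bar>b\<bar> < 1"
  shows "funct 0 b (\<lambda>x. al_salam_chihara n x a b q) = (- a) ^ n * q ^ (n choose 2)"
proof (induction n arbitrary: a)
  case 0
  then show ?case using funct_big_q_hermite[OF b, of 0] by (simp add: numeral_2_eq_2)
next
  case (Suc n)
  define e where "e = (\<lambda>a. funct 0 b (\<lambda>x. al_salam_chihara (Suc n) x a b q))"
  define g where "g = (\<lambda>a. e a - (- a) ^ Suc n * q ^ (Suc n choose 2))"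
  have e: "e a = e (a * q) - a * (1 - q ^ Suc n) * ((- (a * q)) ^ n * q ^ (n choose 2))" for a
    unfolding e_def Suc[symmetric]
    by (subst al_salam_chihara_shift_param)
       (simp add: funct_diff[OF _ _ b] funct_cmult continuous_on_asc continuous_on_mult_left del: al_salam_chihara.simps)
  have pw: "(- (a * q)) ^ k = (- a) ^ k * q ^ k" for a k
    using power_mult_distrib[of "- a" q k] by simp
  have g: "g a = g (a * q)" for a
    unfolding g_def e[of a] pw by (simp add: power_add numeral_2_eq_2 algebra_simps)
  have "g (a * q ^ i) = g a" for i
  proof (induction i)
    case (Suc i)
    then show ?case using g[of "a * q ^ i"] by (simp add: mult_ac)
  qed simp
  moreover have "(\<lambda>i. g (a * q ^ i)) \<longlonglongrightarrow> g 0"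
  proof (rule continuous_on_tendsto_compose[OF _ orbit_LIMSEQ])
    have "continuous_on UNIV e"
      unfolding e_def using b
      by (intro continuous_on_funct) (auto simp: split_beta simp del: al_salam_chihara.simps intro!: continuous_intros)
    then show "continuous_on UNIV g"
      unfolding g_def by (intro continuous_intros)
  qed auto
  ultimately have "g a = g 0"
    by (simp add: LIMSEQ_const_iff)
  also have "g 0 = 0"
    using funct_big_q_hermite[OF b, of "Suc n"] by (simp add: g_def e_def)
  finally show ?case by (simp add: g_def e_def)
qed

end


section \<open>The series\<close>

context q_unit
begin

lemma qfact_ge: "qpochhammer_inf q q \<le> qfact n"
proof -
  have "qfact (Suc n) \<le> qfact n" for n
    using qfact_pos[of n] q_pos by (simp add: qfact_Suc mult_left_le)
  then have "decseq qfact" by (simp add: decseq_Suc_iff)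
  then show ?thesis using qfact_LIMSEQ by (rule decseq_ge)
qed

lemma qpochhammer_inf_q_pos: "0 < qpochhammer_inf q q"
  using nu_pos by (simp add: nu_def zero_less_divide_iff)

definition Phi_term :: "real \<Rightarrow> real \<Rightarrow> nat \<Rightarrow> real" where
  "Phi_term c z k = q ^ (k * (k - 1)) * z ^ k * qpochhammer_inf (c * q ^ k) q / qfact k"

text \<open>Multiplying \<^term>\<open>phi01 c q z\<close> by \<^term>\<open>qpochhammer_inf c q\<close> makes it entire in both
  arguments, so that its contiguous relations hold without exceptional values of \<^term>\<open>c\<close>.\<close>

definition Phi :: "real \<Rightarrow> real \<Rightarrow> real" where
  "Phi c z = (\<Sum>k. Phi_term c z k)"

lemma abs_qpochhammer_inf_le: "\<bar>qpochhammer_inf (c * q ^ k) q\<bar> \<le> exp (\<bar>c\<bar> / (1 - q))"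
proof -
  have "\<bar>qpochhammer_inf (c * q ^ k) q\<bar> \<le> exp (\<bar>c * q ^ k\<bar> / (1 - q))"
    using norm_qpochhammer_inf_le[OF norm_q(2), of "c * q ^ k"] q_pos by simp
  also have "\<dots> \<le> exp (\<bar>c\<bar> / (1 - q))"
    using orbit_le[of c k] q_less_1 by (simp add: divide_right_mono)
  finally show ?thesis .
qed

lemma summable_theta: "summable (\<lambda>k. q ^ (k * (k - 1)) * \<bar>z\<bar> ^ k)"
proof -
  have "(\<lambda>k. q ^ k * \<bar>z\<bar>) \<longlonglongrightarrow> 0 * \<bar>z\<bar>"
    by (intro tendsto_intros LIMSEQ_power_zero norm_q)
  then have "\<forall>\<^sub>F k in sequentially. q ^ k * \<bar>z\<bar> < 1 / 2"
    by (intro order_tendstoD) auto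
  then obtain N where N: "\<And>k. k \<ge> N \<Longrightarrow> q ^ k * \<bar>z\<bar> < 1 / 2"
    unfolding eventually_sequentially by blast
  show ?thesis
  proof (rule summable_ratio_test[of "1 / 2" N])
    fix k assume k: "k \<ge> N"
    have "q ^ (2 * k) * \<bar>z\<bar> \<le> q ^ k * \<bar>z\<bar>"
      using q_pos q_less_1 by (intro mult_right_mono power_decreasing) auto
    then have le: "q ^ (2 * k) * \<bar>z\<bar> \<le> 1 / 2" using N[OF k] by linarith
    have "Suc k * (Suc k - 1) = k * (k - 1) + 2 * k"
      by (cases k) auto
    then have "q ^ (Suc k * (Suc k - 1)) * \<bar>z\<bar> ^ Suc k = (q ^ (2 * k) * \<bar>z\<bar>) * (q ^ (k * (k - 1)) * \<bar>z\<bar> ^ k)"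
      by (simp only: power_add power_Suc mult_ac)
    also have "\<dots> \<le> 1 / 2 * (q ^ (k * (k - 1)) * \<bar>z\<bar> ^ k)"
      using q_pos by (intro mult_right_mono le) auto
    finally show "norm (q ^ (Suc k * (Suc k - 1)) * \<bar>z\<bar> ^ Suc k) \<le> 1 / 2 * norm (q ^ (k * (k - 1)) * \<bar>z\<bar> ^ k)"
      using q_pos by (simp add: abs_mult)
  qed simp
qed

lemma abs_Phi_term_le:
  "\<bar>Phi_term c z k\<bar> \<le> exp (\<bar>c\<bar> / (1 - q)) / qpochhammer_inf q q * (q ^ (k * (k - 1)) * \<bar>z\<bar> ^ k)"
proof -
  have "\<bar>Phi_term c z k\<bar> = (q ^ (k * (k - 1)) * \<bar>z\<bar> ^ k) * (\<bar>qpochhammer_inf (c * q ^ k) q\<bar> / qfact k)"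
    using q_pos qfact_pos[of k] by (simp add: Phi_term_def abs_mult power_abs)
  also have "\<dots> \<le> (q ^ (k * (k - 1)) * \<bar>z\<bar> ^ k) * (exp (\<bar>c\<bar> / (1 - q)) / qpochhammer_inf q q)"
    using q_pos abs_qpochhammer_inf_le[of c k] qfact_ge[of k] qpochhammer_inf_q_pos
    by (intro mult_left_mono frac_le) auto
  finally show ?thesis by (simp add: mult_ac)
qed

lemma summable_Phi_term: "summable (Phi_term c z)"
proof (rule summable_comparison_test')
  show "norm (Phi_term c z k) \<le> exp (\<bar>c\<bar> / (1 - q)) / qpochhammer_inf q q * (q ^ (k * (k - 1)) * \<bar>z\<bar> ^ k)"
    if "0 \<le> k" for k
    using abs_Phi_term_le by simp
qed (intro summable_mult summable_theta)

text \<open>Termwise, by peeling the factor 1 - c q^k off (c q^k;q)_\<infinity> and absorbing q^k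
  into z^k.\<close>

lemma Phi_rec_param: "Phi c z = Phi (c * q) z - c * Phi (c * q) (q * z)"
proof -
  have "Phi_term c z k = Phi_term (c * q) z k - c * Phi_term (c * q) (q * z) k" for k
    unfolding Phi_term_def
    by (subst qpochhammer_inf_rec[OF norm_q(2)])
       (simp add: power_mult_distrib algebra_simps diff_divide_distrib)
  then have "Phi c z = (\<Sum>k. Phi_term (c * q) z k - c * Phi_term (c * q) (q * z) k)"
    by (simp add: Phi_def)
  also have "\<dots> = Phi (c * q) z - c * Phi (c * q) (q * z)"
    unfolding Phi_def
    by (subst suminf_diff[symmetric]) (auto intro!: summable_Phi_term summable_mult simp: suminf_mult summable_Phi_term)
  finally show ?thesis .
qed

text \<open>The difference z^k - (qz)^k contributes 1 - q^k, which cancels against (q;q)_k; the rest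
  is an index shift using (k+1)k = k(k-1) + 2k.\<close>

lemma Phi_rec_argument: "Phi c z = Phi c (q * z) + z * Phi (c * q) (q\<^sup>2 * z)"
proof -
  have eq: "Phi_term c z (Suc k) - Phi_term c (q * z) (Suc k) = z * Phi_term (c * q) (q\<^sup>2 * z) k" for k
  proof -
    have "Suc k * (Suc k - 1) = k * (k - 1) + 2 * k"
      by (cases k) auto
    then have pw: "q ^ (Suc k * (Suc k - 1)) = q ^ (k * (k - 1)) * (q\<^sup>2) ^ k"
      by (simp only: power_add power_mult)
    have "1 - q ^ Suc k \<noteq> 0" using q_power_less_1[of k] by linarith
    then have div: "(1 - q ^ Suc k) / qfact (Suc k) = 1 / qfact k"
      by (simp add: qfact_Suc del: power_Suc)
    have "Phi_term c z (Suc k) - Phi_term c (q * z) (Suc k) =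
        q ^ (Suc k * (Suc k - 1)) * z ^ Suc k * qpochhammer_inf (c * q ^ Suc k) q * ((1 - q ^ Suc k) / qfact (Suc k))"
      unfolding Phi_term_def power_mult_distrib by (simp add: algebra_simps diff_divide_distrib)
    then show ?thesis
      unfolding div pw by (simp add: Phi_term_def power_mult_distrib mult_ac)
  qed
  have "Phi c z - Phi c (q * z) = (\<Sum>k. Phi_term c z k - Phi_term c (q * z) k)"
    unfolding Phi_def by (intro suminf_diff summable_Phi_term)
  also have "\<dots> = (\<Sum>k. Phi_term c z (Suc k) - Phi_term c (q * z) (Suc k))"
    by (subst suminf_split_head) (intro summable_diff summable_Phi_term, simp add: Phi_term_def)
  also have "\<dots> = z * Phi (c * q) (q\<^sup>2 * z)"
    unfolding eq Phi_def by (intro suminf_mult summable_Phi_term)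
  finally show ?thesis by simp
qed

text \<open>The form that matches the shift of \<open>a\<close> in the moments.\<close>

lemma Phi_ladder: "Phi c z = Phi (c * q) (q * z) + (z - c) * Phi (c * q) (q\<^sup>2 * z)"
  unfolding Phi_rec_argument[of c z] Phi_rec_param[of c "q * z"]
  by (simp add: power2_eq_square algebra_simps)

text \<open>The second-order q-difference equation in \<open>z\<close> at fixed \<open>c\<close>,
  obtained by eliminating the values at \<open>c * q\<close>. It becomes a three-term relation in
  the total degree m + n.\<close>

lemma Phi_three_term:
  "q * z * Phi c (q\<^sup>2 * z) = q * (Phi c z - Phi c (q * z)) - c * (Phi c (q * z) - Phi c (q\<^sup>2 * z))"
proof -
  have 1: "Phi c (q\<^sup>2 * z) = Phi (c * q) (q\<^sup>2 * z) - c * Phi (c * q) (q * (q\<^sup>2 * z))"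
    by (rule Phi_rec_param)
  have 2: "Phi c z - Phi c (q * z) = z * Phi (c * q) (q\<^sup>2 * z)"
    using Phi_rec_argument[of c z] by simp
  have 3: "Phi c (q * z) - Phi c (q\<^sup>2 * z) = q * z * Phi (c * q) (q * (q\<^sup>2 * z))"
    using Phi_rec_argument[of c "q * z"] by (simp add: power2_eq_square mult_ac)
  show ?thesis
    unfolding 2 3 by (subst 1) (simp add: algebra_simps)
qed

text \<open>The head of the series is (c;q)_\<infinity> and the tail is O(|z|). This gives the limit
  of the claimed value as \<open>a\<close> grows.\<close>

lemma Phi_minus_1:
  assumes "\<bar>z\<bar> \<le> 1"
  shows "\<bar>Phi c z - 1\<bar> \<le> exp (\<bar>c\<bar> / (1 - q)) / qpochhammer_inf q q * (\<Sum>k. q ^ (k * (k - 1))) * \<bar>z\<bar> +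
    (exp (\<bar>c\<bar> / (1 - q)) - 1)"
proof -
  define K where "K = exp (\<bar>c\<bar> / (1 - q)) / qpochhammer_inf q q"
  have K: "0 \<le> K" using qpochhammer_inf_q_pos by (simp add: K_def)
  have summ: "summable (\<lambda>k. q ^ (k * (k - 1)))" using summable_theta[of 1] by simp
  have summ': "summable (\<lambda>k. q ^ (Suc k * k))" using summ by (subst (asm) summable_Suc_iff[symmetric]) simp
  have le: "\<bar>Phi_term c z (Suc k)\<bar> \<le> K * \<bar>z\<bar> * q ^ (Suc k * k)" for k
  proof -
    have "\<bar>z\<bar> ^ Suc k \<le> \<bar>z\<bar>"
      using assms by (simp add: mult_left_le power_le_one)
    then have "K * (q ^ (Suc k * k) * \<bar>z\<bar> ^ Suc k) \<le> K * (q ^ (Suc k * k) * \<bar>z\<bar>)"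
      using K q_pos by (intro mult_left_mono) auto
    then show ?thesis
      using abs_Phi_term_le[of c z "Suc k"] by (simp add: K_def mult_ac)
  qed
  have "Phi c z - qpochhammer_inf c q = (\<Sum>k. Phi_term c z (Suc k))"
    unfolding Phi_def by (subst suminf_split_head) (auto intro!: summable_Phi_term simp: Phi_term_def)
  also have "\<bar>\<dots>\<bar> \<le> (\<Sum>k. K * \<bar>z\<bar> * q ^ (Suc k * k))"
    using norm_suminf_le[OF _ summable_mult[OF summ'], of "\<lambda>k. Phi_term c z (Suc k)" "K * \<bar>z\<bar>"] le by simp
  also have "\<dots> = K * \<bar>z\<bar> * (\<Sum>k. q ^ (Suc k * k))"
    by (rule suminf_mult[OF summ'])
  also have "(\<Sum>k. q ^ (Suc k * k)) \<le> (\<Sum>k. q ^ (k * (k - 1)))"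
    using suminf_split_head[OF summ] by simp
  finally have "\<bar>Phi c z - qpochhammer_inf c q\<bar> \<le> K * \<bar>z\<bar> * (\<Sum>k. q ^ (k * (k - 1)))"
    using K by (simp add: mult_left_mono)
  moreover have "\<bar>qpochhammer_inf c q - 1\<bar> \<le> exp (\<bar>c\<bar> / (1 - q)) - 1"
    using norm_qpochhammer_inf_minus_1[OF norm_q(2), of c] q_pos by simp
  ultimately show ?thesis by (simp add: K_def mult_ac)
qed

lemma Phi_eq_phi01:
  assumes "\<And>j. c * q ^ j \<noteq> 1"
  shows "Phi c z = qpochhammer_inf c q * phi01 c q z"
proof -
  have nz: "qpochhammer c q k \<noteq> 0" for k
    using assms by (simp add: qpochhammer_def)
  have "Phi_term c z k = qpochhammer_inf c q * (q ^ (k * (k - 1)) * z ^ k / (qpochhammer c q k * qfact k))" for k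
    using nz[of k] unfolding Phi_term_def qpochhammer_inf_split[OF norm_q(2), of c k] by simp
  moreover have "qpochhammer_inf c q \<noteq> 0"
    using assms qpochhammer_inf_eq_0_iff[OF norm_q(2)] by blast
  ultimately have t: "q ^ (k * (k - 1)) * z ^ k / (qpochhammer c q k * qfact k) = Phi_term c z k / qpochhammer_inf c q" for k
    by simp
  show ?thesis
    unfolding phi01_def t Phi_def suminf_divide[OF summable_Phi_term]
    using \<open>qpochhammer_inf c q \<noteq> 0\<close> by simp
qed

section \<open>The functional with theta factor\<close>

text \<open>By \<open>funct_asc\<close> this is the moment for L(0,b); moments divided by it have
  limit 1 along a/q^N.\<close>

definition asc_norm :: "real \<Rightarrow> nat \<Rightarrow> real" where
  "asc_norm a n = (- a) ^ n * q ^ (n choose 2)"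

lemma asc_norm_0 [simp]: "asc_norm a 0 = 1"
  by (simp add: asc_norm_def numeral_2_eq_2)

lemma asc_norm_Suc: "asc_norm a (Suc n) = - (a * q ^ n) * asc_norm a n"
  by (simp add: asc_norm_def numeral_2_eq_2 power_add)

lemma asc_norm_nonzero: "a \<noteq> 0 \<Longrightarrow> asc_norm a n \<noteq> 0"
  using q_pos by (simp add: asc_norm_def)

text \<open>Division by \<open>asc_norm\<close> removes the dominant multiplier -A q^k from the
  recurrence. The two remaining coefficients are at most 1 + 3\<delta> and \<delta> + \<delta>^2,
  whose sum is the factor in the product.\<close>

lemma asc_normalised_le:
  assumes A: "A \<noteq> 0" and b: "\<bar>b\<bar> \<le> 1"
  defines "\<delta> \<equiv> \<lambda>k. 1 / (\<bar>A\<bar> * q ^ k)"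
  shows "\<bar>al_salam_chihara n (cos t) A b q / asc_norm A n\<bar> \<le> (\<Prod>k<n. 1 + (4 * \<delta> k + (\<delta> k)\<^sup>2))"
proof -
  define p where "p = (\<lambda>n. al_salam_chihara n (cos t) A b q / asc_norm A n)"
  define W where "W = (\<lambda>n. \<Prod>k<n. 1 + (4 * \<delta> k + (\<delta> k)\<^sup>2))"
  have \<delta>: "0 < \<delta> k" for k using A q_pos by (simp add: \<delta>_def)
  have W: "0 < W n" for n unfolding W_def using \<delta> by (intro prod_pos) (simp add: add_pos_nonneg less_imp_le)
  have W_Suc: "W (Suc n) = W n * (1 + (4 * \<delta> n + (\<delta> n)\<^sup>2))" for n by (simp add: W_def)
  have W_mono: "W n \<le> W (Suc n)" for n
    using W[of n] \<delta>[of n] by (simp add: W_Suc mult_le_cancel_left1)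
  have lin: "\<bar>2 * cos t - (A + b) * q ^ k\<bar> / (\<bar>A\<bar> * q ^ k) \<le> 1 + 3 * \<delta> k" for k
  proof -
    have qk: "0 < q ^ k" "q ^ k \<le> 1" using q_pos q_less_1 by (auto simp: power_le_one)
    have "\<bar>2 * cos t - (A + b) * q ^ k\<bar> \<le> \<bar>2 * cos t\<bar> + (\<bar>A\<bar> + \<bar>b\<bar>) * q ^ k"
    proof -
      have "\<bar>2 * cos t - (A + b) * q ^ k\<bar> \<le> \<bar>2 * cos t\<bar> + \<bar>A + b\<bar> * q ^ k"
        using abs_triangle_ineq4[of "2 * cos t" "(A + b) * q ^ k"] qk by (simp add: abs_mult)
      also have "\<bar>A + b\<bar> * q ^ k \<le> (\<bar>A\<bar> + \<bar>b\<bar>) * q ^ k"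
        using qk by (intro mult_right_mono) auto
      finally show ?thesis by simp
    qed
    also have "\<dots> \<le> 3 + \<bar>A\<bar> * q ^ k"
    proof -
      have "\<bar>b\<bar> * q ^ k \<le> 1 * 1" using b qk by (intro mult_mono) auto
      moreover have "\<bar>2 * cos t\<bar> \<le> 2" by (simp add: abs_mult)
      ultimately show ?thesis unfolding distrib_right by linarith
    qed
    finally have "\<bar>2 * cos t - (A + b) * q ^ k\<bar> / (\<bar>A\<bar> * q ^ k) \<le> (3 + \<bar>A\<bar> * q ^ k) / (\<bar>A\<bar> * q ^ k)"
      using A qk by (intro divide_right_mono) auto
    also have "\<dots> = 1 + 3 * \<delta> k" using A qk q_pos by (simp add: \<delta>_def add_divide_distrib)
    finally show ?thesis .
  qed
  have "\<bar>p n\<bar> \<le> W n \<and> \<bar>p (Suc n)\<bar> \<le> W (Suc n)"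
  proof (induction n)
    case 0
    have "\<bar>p (Suc 0)\<bar> = \<bar>2 * cos t - (A + b) * q ^ 0\<bar> / (\<bar>A\<bar> * q ^ 0)"
      by (simp add: p_def asc_norm_Suc)
    also have "\<dots> \<le> 1 + 3 * \<delta> 0" by (rule lin)
    also have "\<dots> \<le> W (Suc 0)" using \<delta>[of 0] by (simp add: W_def)
    finally show ?case by (simp add: p_def W_def)
  next
    case (Suc n)
    define B where "B = al_salam_chihara (Suc n) (cos t) A b q"
    define D where "D = al_salam_chihara n (cos t) A b q"
    have qn: "0 < q ^ n" "q ^ n \<le> 1" using q_pos q_less_1 by (auto simp: power_le_one)
    have "p (Suc (Suc n)) =
        - ((2 * cos t - (A + b) * q ^ Suc n) / (A * q ^ Suc n)) * p (Suc n) -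
        ((1 - q ^ Suc n) * (1 - A * b * q ^ n)) / (A * q ^ Suc n * (A * q ^ n)) * p n"
      unfolding p_def al_salam_chihara.simps(3) asc_norm_Suc B_def[symmetric] D_def[symmetric]
      using A qn q_pos asc_norm_nonzero[OF A, of n] by (simp add: divide_simps)
    then have "\<bar>p (Suc (Suc n))\<bar> \<le>
        \<bar>2 * cos t - (A + b) * q ^ Suc n\<bar> / (\<bar>A\<bar> * q ^ Suc n) * \<bar>p (Suc n)\<bar> +
        \<bar>((1 - q ^ Suc n) * (1 - A * b * q ^ n)) / (A * q ^ Suc n * (A * q ^ n))\<bar> * \<bar>p n\<bar>"
    proof -
      have tri: "\<bar>- x * y - z * w\<bar> \<le> \<bar>x\<bar> * \<bar>y\<bar> + \<bar>z\<bar> * \<bar>w\<bar>" for x y z w :: real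
        unfolding abs_mult[symmetric] by linarith
      have "\<bar>(2 * cos t - (A + b) * q ^ Suc n) / (A * q ^ Suc n)\<bar> =
          \<bar>2 * cos t - (A + b) * q ^ Suc n\<bar> / (\<bar>A\<bar> * q ^ Suc n)"
        using q_pos by (simp only: abs_divide abs_mult[of A] abs_of_pos[OF zero_less_power[OF q_pos]])
      with tri \<open>p (Suc (Suc n)) = _\<close> show ?thesis by metis
    qed
    also have "\<dots> \<le> (1 + 3 * \<delta> (Suc n)) * W (Suc n) + (\<delta> (Suc n) + (\<delta> (Suc n))\<^sup>2) * W (Suc n)"
    proof (intro add_mono mult_mono)
      show "\<bar>p n\<bar> \<le> W (Suc n)" using Suc W_mono[of n] by linarith
      have "\<bar>(1 - q ^ Suc n) * (1 - A * b * q ^ n)\<bar> \<le> 1 * (1 + \<bar>A\<bar> * q ^ n)"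
        unfolding abs_mult
      proof (intro mult_mono)
        show "\<bar>1 - q ^ Suc n\<bar> \<le> 1" using q_power_less_1[of n] q_pos by simp
        have "\<bar>A * b * q ^ n\<bar> \<le> \<bar>A\<bar> * q ^ n"
          using b qn by (simp add: abs_mult mult_right_mono mult_left_le)
        then show "\<bar>1 - A * b * q ^ n\<bar> \<le> 1 + \<bar>A\<bar> * q ^ n" by linarith
      qed auto
      then have "\<bar>((1 - q ^ Suc n) * (1 - A * b * q ^ n)) / (A * q ^ Suc n * (A * q ^ n))\<bar> \<le>
          (1 + \<bar>A\<bar> * q ^ n) / (\<bar>A\<bar> * q ^ Suc n * (\<bar>A\<bar> * q ^ n))"
        using A q_pos by (simp add: abs_mult divide_right_mono)
      also have "\<dots> = \<delta> (Suc n) + q * (\<delta> (Suc n))\<^sup>2"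
        using A q_pos by (simp add: \<delta>_def power2_eq_square divide_simps)
      also have "\<dots> \<le> \<delta> (Suc n) + (\<delta> (Suc n))\<^sup>2"
        using q_pos q_less_1 by (simp add: mult_left_le_one_le)
      finally show "\<bar>((1 - q ^ Suc n) * (1 - A * b * q ^ n)) / (A * q ^ Suc n * (A * q ^ n))\<bar> \<le> \<delta> (Suc n) + (\<delta> (Suc n))\<^sup>2" .
    qed (use lin[of "Suc n"] Suc \<delta>[of "Suc n"] in \<open>auto intro!: add_nonneg_nonneg\<close>)
    also have "\<dots> = W (Suc (Suc n))"
      by (simp add: W_Suc[of "Suc n"] algebra_simps)
    finally show ?case using Suc by simp
  qed
  then show ?thesis by (simp add: p_def W_def)
qed

text \<open>For A = a/q^N and degrees up to m + N the numbers \<delta> form a geometric progression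
  ending at a value free of N. This range is the one reached from degree m after N steps of the
  ladder.\<close>

lemma asc_normalised_orbit_bounded:
  assumes a: "a \<noteq> 0" and b: "\<bar>b\<bar> \<le> 1"
  shows "\<exists>C. \<forall>N n t. n \<le> m + N \<longrightarrow>
    \<bar>al_salam_chihara n (cos t) (a / q ^ N) b q / asc_norm (a / q ^ N) n\<bar> \<le> C"
proof (intro exI allI impI)
  fix N n t assume n: "n \<le> m + N"
  define A where "A = a / q ^ N"
  define \<delta> where "\<delta> = (\<lambda>k. 1 / (\<bar>A\<bar> * q ^ k))"
  \<comment> \<open>The value of \<delta> at the last index k = m + N - 1.\<close>
  define D where "D = q / (q ^ m * \<bar>a\<bar>)"
  have D: "0 < D" using a q_pos by (simp add: D_def)
  have A: "A \<noteq> 0" using a q_pos by (simp add: A_def)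
  have \<delta>: "0 < \<delta> k" for k using A q_pos by (simp add: \<delta>_def)
  have "\<bar>al_salam_chihara n (cos t) A b q / asc_norm A n\<bar> \<le> (\<Prod>k<n. 1 + (4 * \<delta> k + (\<delta> k)\<^sup>2))"
    unfolding \<delta>_def by (rule asc_normalised_le[OF A b])
  also have "\<dots> \<le> exp (\<Sum>k<n. 4 * \<delta> k + (\<delta> k)\<^sup>2)"
    using \<delta> by (intro prod_le_exp_sum) (simp add: less_imp_le)
  also have "(\<Sum>k<n. 4 * \<delta> k + (\<delta> k)\<^sup>2) \<le> (\<Sum>k<m + N. 4 * \<delta> k + (\<delta> k)\<^sup>2)"
    using n \<delta> by (intro sum_mono2) (auto simp: less_imp_le)
  also have "\<dots> \<le> (\<Sum>k<m + N. (4 * D + D\<^sup>2) * q ^ (m + N - Suc k))"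
  proof (intro sum_mono)
    fix k assume "k \<in> {..<m + N}"
    then have "m + N = (m + N - Suc k) + k + 1" by simp
    then have "q ^ (m + N) = q ^ (m + N - Suc k) * q ^ k * q"
      by (metis power_add power_one_right)
    then have "\<delta> k = D * q ^ (m + N - Suc k)"
      using a q_pos by (simp add: \<delta>_def D_def A_def power_add field_simps)
    moreover have "(q ^ (m + N - Suc k))\<^sup>2 \<le> q ^ (m + N - Suc k)"
      using q_pos q_less_1 by (simp add: power2_eq_square mult_left_le power_le_one)
    ultimately show "4 * \<delta> k + (\<delta> k)\<^sup>2 \<le> (4 * D + D\<^sup>2) * q ^ (m + N - Suc k)"
      by (simp add: power_mult_distrib distrib_right mult_left_mono)
  qed
  also have "\<dots> = (4 * D + D\<^sup>2) * (\<Sum>k<m + N. q ^ k)"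
    unfolding sum_distrib_left[symmetric] by (subst sum.nat_diff_reindex) simp
  also have "\<dots> \<le> (4 * D + D\<^sup>2) * (1 / (1 - q))"
    using D q_pos q_less_1 by (intro mult_left_mono sum_power_le) auto
  finally show "\<bar>al_salam_chihara n (cos t) (a / q ^ N) b q / asc_norm (a / q ^ N) n\<bar>
      \<le> exp ((4 * D + D\<^sup>2) * (1 / (1 - q)))"
    by (simp add: A_def)
qed

text \<open>One step leads from (N,n) to (N+1,n+1) and (N+1,n), both again in the region n \<le> m +
  N. The accumulated factor is a convergent product, so a bound \<open>e\<close> at any single level
  N controls the origin with a constant independent of N.\<close>

lemma triangular_system_bound:
  fixes d :: "nat \<Rightarrow> nat \<Rightarrow> real"
  assumes step: "\<And>N n. n \<le> m + N \<Longrightarrow> \<bar>d N n\<bar> \<le> \<bar>d (Suc N) (Suc n)\<bar> + K * q ^ N * \<bar>d (Suc N) n\<bar>"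
    and K: "0 \<le> K" and bound: "\<And>n. n \<le> m + N \<Longrightarrow> \<bar>d N n\<bar> \<le> e"
  shows "\<bar>d 0 m\<bar> \<le> exp (K / (1 - q)) * e"
proof -
  have "\<bar>d 0 m\<bar> \<le> (\<Prod>k<N. 1 + K * q ^ k) * e"
    using bound
  proof (induction N arbitrary: e)
    case (Suc N)
    have "\<bar>d N n\<bar> \<le> (1 + K * q ^ N) * e" if "n \<le> m + N" for n
    proof -
      have "\<bar>d N n\<bar> \<le> \<bar>d (Suc N) (Suc n)\<bar> + K * q ^ N * \<bar>d (Suc N) n\<bar>" by (rule step[OF that])
      also have "\<dots> \<le> e + K * q ^ N * e"
        using that K q_pos by (intro add_mono mult_left_mono Suc.prems) auto
      finally show ?thesis by (simp add: algebra_simps)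
    qed
    from Suc.IH[OF this] show ?case by (simp add: mult_ac)
  qed simp
  also have "(\<Prod>k<N. 1 + K * q ^ k) \<le> exp (\<Sum>k<N. K * q ^ k)"
    using K q_pos by (intro prod_le_exp_sum) auto
  also have "(\<Sum>k<N. K * q ^ k) = K * (\<Sum>k<N. q ^ k)"
    by (simp add: sum_distrib_left)
  also have "\<dots> \<le> K * (1 / (1 - q))"
    using K q_pos q_less_1 by (intro mult_left_mono sum_power_le) auto
  finally show ?thesis
    using order.trans[OF abs_ge_zero bound[of 0]] by (simp add: mult_right_mono)
qed

end


section \<open>Moments of the functional L(q/a,b)\<close>

lemma al_salam_chihara_recurrence:
  "2 * x * al_salam_chihara n x a b q = al_salam_chihara (Suc n) x a b q +
     (a + b) * q ^ n * al_salam_chihara n x a b q +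
     (1 - q ^ n) * (1 - a * b * q ^ (n - 1)) * al_salam_chihara (n - 1) x a b q"
  by (cases n) (simp_all add: algebra_simps)

context q_unit
begin

definition theta_moment :: "real \<Rightarrow> real \<Rightarrow> nat \<Rightarrow> real" where
  "theta_moment b a n = funct (q / a) b (\<lambda>x. al_salam_chihara n x a b q) / asc_norm a n"

text \<open>The claimed value of \<open>theta_moment\<close>, including the factor
  (qb/a;q)_\<infinity>. The argument is q^(2-n)/a^2.\<close>

definition theta_value :: "real \<Rightarrow> real \<Rightarrow> nat \<Rightarrow> real" where
  "theta_value b a n = Phi (q * b / a) (q\<^sup>2 / (q ^ n * a\<^sup>2))"

text \<open>Replacing \<open>a\<close> by \<open>a * q\<close> changes the numerator parameter from
  q/a to 1/a. The linear factor this adds to the weight is 1/a^2 times the Christoffel factor, so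
  one identity handles the weight and the polynomial together.\<close>

lemma theta_moment_shift:
  assumes a: "a \<noteq> 0" and b: "\<bar>b\<bar> < 1"
  shows "theta_moment b (a * q) n =
    theta_moment b a (Suc n) + (1 / (q ^ n * a\<^sup>2) - b / a) * theta_moment b a n"
proof -
  define I where "I = (\<lambda>n. funct (q / a) b (\<lambda>x. al_salam_chihara n x a b q))"
  have "funct (q / (a * q)) b (\<lambda>x. al_salam_chihara n x (a * q) b q) =
      funct (q / a) b (\<lambda>x. (1 + (1 / a)\<^sup>2 - 2 * (1 / a) * x) * al_salam_chihara n x (a * q) b q)"
    using q_pos funct_shift_numerator[of "1 / a" b "\<lambda>x. al_salam_chihara n x (a * q) b q"] by simp
  also have "(\<lambda>x. (1 + (1 / a)\<^sup>2 - 2 * (1 / a) * x) * al_salam_chihara n x (a * q) b q) =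
      (\<lambda>x. 1 / a\<^sup>2 * ((1 + a\<^sup>2 - 2 * a * x) * al_salam_chihara n x (a * q) b q))"
    using a by (intro ext) (simp add: field_simps power2_eq_square)
  also have "funct (q / a) b \<dots> = 1 / a\<^sup>2 * ((1 - a * b * q ^ n) * I n - a * I (Suc n))"
    unfolding al_salam_chihara_christoffel I_def
    by (simp only: funct_diff[OF _ _ b] funct_cmult continuous_on_asc continuous_on_mult continuous_on_const)
  finally have eq: "theta_moment b (a * q) n =
      1 / a\<^sup>2 * ((1 - a * b * q ^ n) * I n - a * I (Suc n)) / asc_norm (a * q) n"
    by (simp add: theta_moment_def)
  have moment: "theta_moment b a n = I n / asc_norm a n" for n
    by (simp add: theta_moment_def I_def)
  have "(- (a * q)) ^ n = (- a) ^ n * q ^ n"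
    using power_mult_distrib[of "- a" q n] by simp
  then have "asc_norm (a * q) n = q ^ n * asc_norm a n"
    by (simp add: asc_norm_def)
  then show ?thesis
    unfolding eq moment asc_norm_Suc
    using a q_pos asc_norm_nonzero[OF a, of n] by (simp add: field_simps power2_eq_square)
qed

lemma theta_value_shift:
  assumes a: "a \<noteq> 0"
  shows "theta_value b (a * q) n =
    theta_value b a (Suc n) + (1 / (q ^ n * a\<^sup>2) - b / a) * theta_value b a n"
proof -
  have eqs: "q * b / (a * q) = b / a" "q\<^sup>2 / (q ^ n * (a * q)\<^sup>2) = 1 / (q ^ n * a\<^sup>2)"
    "b / a * q = q * b / a" "q * (1 / (q ^ n * a\<^sup>2)) = q\<^sup>2 / (q ^ Suc n * a\<^sup>2)"
    "q\<^sup>2 * (1 / (q ^ n * a\<^sup>2)) = q\<^sup>2 / (q ^ n * a\<^sup>2)"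
    using q_pos by (simp_all add: power_mult_distrib power2_eq_square)
  then show ?thesis
    unfolding theta_value_def using Phi_ladder[of "b / a" "1 / (q ^ n * a\<^sup>2)"] by (simp only: eqs)
qed

text \<open>The difference \<open>d\<close> of the two sides satisfies the homogeneous ladder along
  a/q^N. Both sides tend to 1 uniformly for n \<le> m + N, so \<open>triangular_system_bound\<close>
  forces the difference at level 0 to vanish.\<close>

lemma theta_moment_eq:
  assumes a: "a \<noteq> 0" and b: "\<bar>b\<bar> < 1"
  shows "theta_moment b a m = theta_value b a m"
proof -
  define A where "A = (\<lambda>N. a / q ^ N)"
  define d where "d = (\<lambda>N n. theta_moment b (A N) n - theta_value b (A N) n)"
  \<comment> \<open>\<open>K * q ^ N\<close> bounds the ladder coefficient; its first summand comes
    from the extreme degree n = m + N.\<close>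
  define K where "K = q\<^sup>2 / (q ^ m * a\<^sup>2) + q / \<bar>a\<bar>"
  have A: "A N \<noteq> 0" for N using a q_pos by (simp add: A_def)
  have A_Suc: "A (Suc N) * q = A N" for N using q_pos by (simp add: A_def)
  have K: "0 \<le> K" using q_pos by (simp add: K_def)
  have step: "\<bar>d N n\<bar> \<le> \<bar>d (Suc N) (Suc n)\<bar> + K * q ^ N * \<bar>d (Suc N) n\<bar>" if n: "n \<le> m + N" for N n
  proof -
    define c where "c = 1 / (q ^ n * (A (Suc N))\<^sup>2) - b / A (Suc N)"
    have "d N n = d (Suc N) (Suc n) + c * d (Suc N) n"
      using theta_moment_shift[OF A b, of "Suc N" n] theta_value_shift[OF A, of b "Suc N" n]
      unfolding A_Suc d_def c_def[symmetric] by (simp add: algebra_simps)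
    then have "\<bar>d N n\<bar> \<le> \<bar>d (Suc N) (Suc n)\<bar> + \<bar>c\<bar> * \<bar>d (Suc N) n\<bar>"
      unfolding abs_mult[symmetric] by linarith
    moreover have "\<bar>c\<bar> \<le> K * q ^ N"
    proof -
      have "1 / (q ^ n * (A (Suc N))\<^sup>2) \<le> 1 / (q ^ (m + N) * (A (Suc N))\<^sup>2)"
        using n q_pos q_less_1 A[of "Suc N"] by (intro divide_left_mono mult_right_mono power_decreasing) auto
      also have "\<dots> = q\<^sup>2 / (q ^ m * a\<^sup>2) * q ^ N"
        using a q_pos by (simp add: A_def power_add power_divide field_simps power2_eq_square)
      finally have "1 / (q ^ n * (A (Suc N))\<^sup>2) \<le> q\<^sup>2 / (q ^ m * a\<^sup>2) * q ^ N" .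
      moreover have "\<bar>b / A (Suc N)\<bar> \<le> q / \<bar>a\<bar> * q ^ N"
        using b a q_pos by (simp add: A_def abs_mult divide_right_mono mult_left_le_one_le)
      moreover have "0 \<le> 1 / (q ^ n * (A (Suc N))\<^sup>2)" using q_pos by simp
      ultimately show ?thesis unfolding c_def K_def distrib_right by linarith
    qed
    ultimately show ?thesis
      by (meson abs_ge_zero add_left_mono mult_right_mono order_trans)
  qed
  obtain C where C: "\<And>N n t. n \<le> m + N \<Longrightarrow> \<bar>al_salam_chihara n (cos t) (A N) b q / asc_norm (A N) n\<bar> \<le> C"
    using asc_normalised_orbit_bounded[OF a, of b m] b unfolding A_def by (metis less_imp_le)
  define T where "T = (\<Sum>k. q ^ (k * (k - 1))) / qpochhammer_inf q q"
  define E where "E = (\<lambda>N. exp (\<bar>q * b / A N\<bar> / (1 - q)))"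
  define Z where "Z = (\<lambda>N. q\<^sup>2 / (q ^ m * a\<^sup>2) * q ^ N)"
  \<comment> \<open>The first summand is the error of the moment by
    \<open>funct_abs_diff_le\<close>, the second that of the series by
    \<open>Phi_minus_1\<close>.\<close>
  define e where "e = (\<lambda>N. C * (exp (2 * \<bar>q / A N\<bar> / (1 - q)) - 1) + (E N * T * Z N + (E N - 1)))"
  have bound: "\<bar>d N n\<bar> \<le> e N" if n: "n \<le> m + N" and Z: "Z N \<le> 1" for N n
  proof -
    let ?p = "\<lambda>x. 1 / asc_norm (A N) n * al_salam_chihara n x (A N) b q"
    have "\<bar>funct (q / A N) b ?p - funct 0 b ?p\<bar> \<le> C * (exp (2 * \<bar>q / A N\<bar> / (1 - q)) - 1) * funct 0 b (\<lambda>_. 1)"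
      by (rule funct_abs_diff_le) (use C[OF n] b asc_norm_nonzero[OF A, of N n] in \<open>auto intro!: continuous_intros\<close>)
    moreover have "funct 0 b (\<lambda>_. 1) = 1"
      using funct_big_q_hermite[OF b, of 0] by simp
    moreover have "funct 0 b ?p = 1"
      unfolding funct_cmult funct_asc[OF b] asc_norm_def[symmetric] using asc_norm_nonzero[OF A] by simp
    moreover have "funct (q / A N) b ?p = theta_moment b (A N) n"
      unfolding funct_cmult theta_moment_def by simp
    ultimately have 1: "\<bar>theta_moment b (A N) n - 1\<bar> \<le> C * (exp (2 * \<bar>q / A N\<bar> / (1 - q)) - 1)"
      by simp
    define z where "z = q\<^sup>2 / (q ^ n * (A N)\<^sup>2)"
    have z0: "0 \<le> z" using q_pos by (simp add: z_def)
    have "z \<le> q\<^sup>2 / (q ^ (m + N) * (A N)\<^sup>2)"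
      unfolding z_def using n q_pos q_less_1 A[of N] by (intro divide_left_mono mult_right_mono power_decreasing) auto
    also have "\<dots> = Z N"
      using a q_pos by (simp add: A_def Z_def power_add power_divide field_simps power2_eq_square)
    finally have z: "z \<le> Z N" .
    have "0 \<le> (\<Sum>k. q ^ (k * (k - 1)))"
      using q_pos summable_theta[of 1] by (intro suminf_nonneg) auto
    then have T: "0 \<le> T" using qpochhammer_inf_q_pos by (simp add: T_def)
    have "\<bar>Phi (q * b / A N) z - 1\<bar> \<le> E N * T * z + (E N - 1)"
      using Phi_minus_1[of z "q * b / A N"] z z0 Z by (simp add: E_def T_def)
    also have "\<dots> \<le> E N * T * Z N + (E N - 1)"
      using z T by (intro add_right_mono mult_left_mono) (auto simp: E_def)
    finally have 2: "\<bar>theta_value b (A N) n - 1\<bar> \<le> E N * T * Z N + (E N - 1)"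
      by (simp add: theta_value_def z_def)
    show ?thesis using 1 2 unfolding d_def e_def by linarith
  qed
  have q0: "(\<lambda>N. q ^ N) \<longlonglongrightarrow> 0" using norm_q(2) by (rule LIMSEQ_power_zero)
  have c0: "(\<lambda>N. r / A N) \<longlonglongrightarrow> 0" for r
    using tendsto_mult_right_zero[OF q0, of "r / a"] by (simp add: A_def)
  have "e \<longlonglongrightarrow> C * (exp (2 * \<bar>0\<bar> / (1 - q)) - 1) +
      (exp (\<bar>0\<bar> / (1 - q)) * T * (q\<^sup>2 / (q ^ m * a\<^sup>2) * 0) + (exp (\<bar>0\<bar> / (1 - q)) - 1))"
    unfolding e_def E_def Z_def using q_less_1 by (intro tendsto_intros c0 q0) auto
  then have e0: "e \<longlonglongrightarrow> 0" by simp
  have "Z \<longlonglongrightarrow> 0"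
    unfolding Z_def by (rule tendsto_mult_right_zero[OF q0])
  then have "\<forall>\<^sub>F N in sequentially. Z N < 1"
    by (rule order_tendstoD) simp
  then have "\<forall>\<^sub>F N in sequentially. \<bar>d 0 m\<bar> \<le> exp (K / (1 - q)) * e N"
  proof (rule eventually_mono)
    fix N assume "Z N < 1"
    then show "\<bar>d 0 m\<bar> \<le> exp (K / (1 - q)) * e N"
      by (intro triangular_system_bound[where d = d and N = N] step K bound) auto
  qed
  moreover have "(\<lambda>N. exp (K / (1 - q)) * e N) \<longlonglongrightarrow> 0"
    by (rule tendsto_mult_right_zero[OF e0])
  ultimately have "\<bar>d 0 m\<bar> \<le> 0"
    by (intro tendsto_lowerbound[where F = sequentially]) auto
  then show ?thesis by (simp add: d_def A_def)
qed

text \<open>\<open>Phi_three_term\<close> at c = qb/a, where raising the index by one divides the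
  argument by q.\<close>

lemma theta_value_recurrence:
  assumes a: "a \<noteq> 0"
  shows "- a * theta_value b a (Suc (Suc s)) + (a + b) * theta_value b a (Suc s) +
    (q / (a * q ^ Suc s) - b) * theta_value b a s = 0"
proof -
  define z where "z = q\<^sup>2 / (q ^ Suc (Suc s) * a\<^sup>2)"
  have z: "q\<^sup>2 / (q ^ Suc s * a\<^sup>2) = q * z" "q\<^sup>2 / (q ^ s * a\<^sup>2) = q\<^sup>2 * z"
    using q_pos by (simp_all add: z_def power2_eq_square)
  define P where "P = Phi (q * b / a)"
  have "q * (a * z * P (q\<^sup>2 * z)) = q * (a * (P z - P (q * z)) - b * (P (q * z) - P (q\<^sup>2 * z)))"
    using Phi_three_term[of z "q * b / a"] a unfolding P_def[symmetric] by (simp add: field_simps)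
  then have "a * z * P (q\<^sup>2 * z) = a * (P z - P (q * z)) - b * (P (q * z) - P (q\<^sup>2 * z))"
    using q_pos by (subst (asm) mult_left_cancel) auto
  moreover have "q / (a * q ^ Suc s) = a * z"
    using a q_pos by (simp add: z_def power2_eq_square)
  ultimately show ?thesis
    unfolding theta_value_def z z_def[symmetric] P_def[symmetric] by (simp add: algebra_simps)
qed

text \<open>Applying 2x to either factor gives two expansions of the same integral. Their equality
  expresses the entry (m, n+1) through entries of second index at most n, starting from
  \<open>theta_moment_eq\<close>.\<close>

lemma funct_asc_mult:
  assumes a: "a \<noteq> 0" and b: "\<bar>b\<bar> < 1"
  shows "funct (q / a) b (\<lambda>x. al_salam_chihara m x a b q * al_salam_chihara n x a b q) =
    asc_norm a m * asc_norm a n * theta_value b a (m + n)"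
proof -
  define g where "g = (\<lambda>m n. funct (q / a) b (\<lambda>x. al_salam_chihara m x a b q * al_salam_chihara n x a b q))"
  define \<gamma> where "\<gamma> = (\<lambda>n. (1 - q ^ n) * (1 - a * b * q ^ (n - 1)))"
  \<comment> \<open>The recurrence coefficient \<gamma> after normalisation by
    \<open>asc_norm\<close>; both vanish at 0, so the index n - 1 causes no harm there.\<close>
  define \<kappa> where "\<kappa> = (\<lambda>n. b + q / a - b * q ^ n - q / (a * q ^ n))"
  define F where "F = theta_value b a"
  have g_rec: "funct (q / a) b (\<lambda>x. 2 * x * (al_salam_chihara m x a b q * al_salam_chihara n x a b q)) =
      g (Suc m) n + (a + b) * q ^ m * g m n + \<gamma> m * g (m - 1) n" for m n
  proof -
    have "2 * x * (al_salam_chihara m x a b q * al_salam_chihara n x a b q) =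
        al_salam_chihara (Suc m) x a b q * al_salam_chihara n x a b q +
        (a + b) * q ^ m * (al_salam_chihara m x a b q * al_salam_chihara n x a b q) +
        \<gamma> m * (al_salam_chihara (m - 1) x a b q * al_salam_chihara n x a b q)" for x
      unfolding mult.assoc[symmetric, of "2 * x"] al_salam_chihara_recurrence \<gamma>_def
      by (simp only: distrib_right mult.assoc)
    then show ?thesis
      unfolding g_def
      by (simp only: funct_add[OF _ _ b] funct_cmult continuous_on_asc continuous_on_mult continuous_on_add continuous_on_const)
  qed
  have g_comm: "g m n = g n m" for m n
    by (simp add: g_def mult.commute)
  have \<gamma>: "\<gamma> n * asc_norm a (n - 1) = asc_norm a n * \<kappa> n" for n
  proof (cases n)
    case (Suc k)
    then show ?thesis
      using a q_pos by (simp add: \<gamma>_def \<kappa>_def asc_norm_Suc field_simps)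
  qed (simp add: \<gamma>_def \<kappa>_def)
  have \<gamma>0: "\<gamma> 0 = 0" by (simp add: \<gamma>_def)
  have step: "g m (Suc n) = g (Suc m) n + (a + b) * (q ^ m - q ^ n) * g m n + \<gamma> m * g (m - 1) n - \<gamma> n * g m (n - 1)" for m n
    using g_rec[of m n] g_rec[of n m] g_comm[of n m] g_comm[of "Suc n" m] g_comm[of "n - 1" m]
    by (simp add: algebra_simps)
  have "g m n = asc_norm a m * asc_norm a n * F (m + n)"
  proof (induction n arbitrary: m rule: less_induct)
    case (less n)
    show ?case
    proof (cases n)
      case 0
      have "g m 0 = asc_norm a m * theta_moment b a m"
        using asc_norm_nonzero[OF a] by (simp add: g_def theta_moment_def)
      then show ?thesis using 0 theta_moment_eq[OF a b] by (simp add: F_def)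
    next
      case (Suc k)
      have IH: "g m k = asc_norm a m * asc_norm a k * F (m + k)" for m
        using less Suc by simp
      show ?thesis
      proof (cases "m + k")
        \<comment> \<open>Here m = 0 and n = 1: the three-term relation would need the index m + k -
          1, so the symmetry of \<open>g\<close> is used instead.\<close>
        case 0
        then show ?thesis using Suc IH[of 1] g_comm[of 0 1] by simp
      next
        case (Suc r)
        have 1: "\<gamma> m * g (m - 1) k = asc_norm a m * asc_norm a k * \<kappa> m * F r"
        proof (cases "m = 0")
          case True
          then show ?thesis by (simp add: \<gamma>0 \<kappa>_def)
        next
          case False
          then have r: "m - 1 + k = r" using Suc by simp
          have "\<gamma> m * g (m - 1) k = (\<gamma> m * asc_norm a (m - 1)) * asc_norm a k * F r"
            unfolding IH r by (simp only: mult.assoc)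
          then show ?thesis unfolding \<gamma> by (simp add: mult_ac)
        qed
        have 2: "\<gamma> k * g m (k - 1) = asc_norm a m * asc_norm a k * \<kappa> k * F r"
        proof (cases "k = 0")
          case True
          then show ?thesis by (simp add: \<gamma>0 \<kappa>_def)
        next
          case False
          then have "m + (k - 1) = r" using Suc by simp
          moreover have "g m (k - 1) = asc_norm a m * asc_norm a (k - 1) * F (m + (k - 1))"
            using less \<open>n = Suc k\<close> by simp
          ultimately show ?thesis using \<gamma>[of k] by (simp add: mult_ac)
        qed
        have qr: "q ^ Suc r = q ^ m * q ^ k" using Suc by (simp add: power_add[symmetric])
        have "F (Suc (Suc r)) = ((a + b) * F (Suc r) + (q / (a * (q ^ m * q ^ k)) - b) * F r) / a"
          using theta_value_recurrence[OF a, of b r] a unfolding qr F_def[symmetric] by (simp add: field_simps)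
        then have F2: "F (Suc m + k) = ((a + b) * F (Suc r) + (q / (a * (q ^ m * q ^ k)) - b) * F r) / a"
          using Suc by simp
        have "g m (Suc k) = asc_norm a m * asc_norm a k *
            (- (a * q ^ m) * F (Suc m + k) + (a + b) * (q ^ m - q ^ k) * F (Suc r) + \<kappa> m * F r - \<kappa> k * F r)"
          unfolding step[of m k] 1 2 unfolding IH Suc asc_norm_Suc by (simp add: algebra_simps)
        also have "- (a * q ^ m) * F (Suc m + k) + (a + b) * (q ^ m - q ^ k) * F (Suc r) + \<kappa> m * F r - \<kappa> k * F r =
            - (a * q ^ k) * F (Suc m + k)"
          unfolding F2 \<kappa>_def using a q_pos by (simp add: field_simps)
        finally show ?thesis
          using \<open>n = Suc k\<close> by (simp add: asc_norm_Suc mult_ac)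
      qed
    qed
  qed
  then show ?thesis by (simp add: g_def F_def)
qed

end

text \<open>The last hypothesis says that (qb/a;q)_\<infinity> and all (qb/a;q)_k are nonzero, so
  that both sides have nonzero denominators and \<open>Phi\<close> can be turned back into
  \<open>phi01\<close>.\<close>

theorem mainTheorem3:
  fixes q a b :: real and m n :: nat
  assumes "0 < q" and "q < 1"
    and "0 < \<bar>a\<bar>" and "\<bar>a\<bar> < 1" and "\<bar>b\<bar> < 1"
    and "\<And>j::nat. q * b / a * q ^ j \<noteq> 1"
  shows "qpochhammer_inf q q / (2 * pi * qpochhammer_inf (q * b / a) q) *
      integral {0..pi} (\<lambda>\<theta>.
        al_salam_chihara m (cos \<theta>) a b q * al_salam_chihara n (cos \<theta>) a b q *
        (cmod (qpochhammer_inf (exp (2 * \<i> * complex_of_real \<theta>)) (complex_of_real q) *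
               qpochhammer_inf (complex_of_real q * exp (\<i> * complex_of_real \<theta>) / complex_of_real a)
                 (complex_of_real q) /
               qpochhammer_inf (complex_of_real b * exp (\<i> * complex_of_real \<theta>)) (complex_of_real q)))\<^sup>2)
    = (- a) ^ (m + n) * q ^ ((m * (m - 1) + n * (n - 1)) div 2) *
      phi01 (q * b / a) q (q powi (2 - int m - int n) / a\<^sup>2)"
proof -
  interpret q_unit q by standard (use assms in auto)
  have a: "a \<noteq> 0" using assms by auto
  have integrand: "(cmod (qpochhammer_inf (exp (2 * \<i> * complex_of_real t)) (complex_of_real q) *
         qpochhammer_inf (complex_of_real q * exp (\<i> * complex_of_real t) / complex_of_real a) (complex_of_real q) /
         qpochhammer_inf (complex_of_real b * exp (\<i> * complex_of_real t)) (complex_of_real q)))\<^sup>2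
      = vweight t * rfac (q / a) t / rfac b t" for t
  proof -
    have "exp (2 * \<i> * complex_of_real t) = cis (2 * t)" "exp (\<i> * complex_of_real t) = cis t"
      by (simp_all add: cis_conv_exp mult_ac)
    then show ?thesis
      by (simp add: vweight_def rfac_def norm_mult norm_divide power_mult_distrib power_divide)
  qed
  define I where "I = integral {0..pi} (\<lambda>t. al_salam_chihara m (cos t) a b q * al_salam_chihara n (cos t) a b q *
      (vweight t * rfac (q / a) t / rfac b t))"
  have "nu * I = asc_norm a m * asc_norm a n * theta_value b a (m + n)"
    using funct_asc_mult[OF a assms(5), of m n] by (simp add: funct_def I_def)
  also have "theta_value b a (m + n) = qpochhammer_inf (q * b / a) q * phi01 (q * b / a) q (q\<^sup>2 / (q ^ (m + n) * a\<^sup>2))"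
    unfolding theta_value_def by (rule Phi_eq_phi01) (rule assms(6))
  also have "q\<^sup>2 / (q ^ (m + n) * a\<^sup>2) = q powi (2 - int m - int n) / a\<^sup>2"
  proof -
    have "q powi (2 - int m - int n) = q powi (int 2 - int (m + n))" by (simp add: algebra_simps)
    also have "\<dots> = q\<^sup>2 / q ^ (m + n)"
      using assms(1) by (subst power_int_diff) (simp_all del: of_nat_add)
    finally show ?thesis by simp
  qed
  also have "asc_norm a m * asc_norm a n = (- a) ^ (m + n) * q ^ ((m * (m - 1) + n * (n - 1)) div 2)"
  proof -
    \<comment> \<open>The integer division is exact, both summands being even.\<close>
    have "(m * (m - 1) + n * (n - 1)) div 2 = (m choose 2) + (n choose 2)"
      unfolding choose_two by (rule div_add) auto
    then show ?thesis by (simp add: asc_norm_def power_add)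
  qed
  finally have "nu * I = (- a) ^ (m + n) * q ^ ((m * (m - 1) + n * (n - 1)) div 2) *
      (qpochhammer_inf (q * b / a) q * phi01 (q * b / a) q (q powi (2 - int m - int n) / a\<^sup>2))" .
  moreover have "qpochhammer_inf (q * b / a) q \<noteq> 0"
    using assms(6) qpochhammer_inf_eq_0_iff[OF norm_q(2)] by blast
  ultimately show ?thesis
    unfolding integrand I_def[symmetric] by (simp add: nu_def field_simps)
qed

end
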